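(* Let $M\subset\mathbb R^3_1$ be an analytic surface with a cross-cap singularity at ${\rm p}$ and suppose that the tangential direction at ${\rm p}$ is spacelike or timelike. Then $m_u({\rm p})=1$.
   Context: $\mathbb R^3_1$ is $\mathbb R^3$ with the pseudo-scalar product $\langle u,v\rangle=u_0v_0+u_1v_1-u_2v_2$; a non-zero vector $w$ is spacelike, lightlike or timelike if $\langle w,w\rangle$ is $>0$, $=0$, $<0$; $\langle u\times v,w\rangle=\det(u,v,w)$. $M$ has a cross-cap singularity at ${\rm p}$ if it is parametrised near ${\rm p}=\mathbf x(q)$ by a map germ $\mathbf x:(\mathbb R^2,q)\to(\mathbb R^3,{\rm p})$ equal, up to germs of diffeomorphisms in source and target, to $(x,y)\mapsto(x,xy,y^2)$. The tangential direction is the direction of the $1$-dimensional image of $d\mathbf x_q$. For the parametrisation $\mathbf x(u,v)$ put $E=\langle \mathbf x_u,\mathbf x_u\rangle$, $F=\langle \mathbf x_u,\mathbf x_v\rangle$, $G=\langle \mathbf x_v,\mathbf x_v\rangle$, $\bar l=\langle \mathbf x_u\times \mathbf x_v,\mathbf x_{uu}\rangle$, $\bar m=\langle \mathbf x_u\times \mathbf x_v,\mathbf x_{uv}\rangle$, $\bar n=\langle \mathbf x_u\times \mathbf x_v,\mathbf x_{vv}\rangle$, $\mathfrak b=E\bar n-G\bar l$, $\mathfrak c=E\bar m-F\bar l$. The equation of the lines of principal curvature extends to the singular point as $(F\bar n-G\bar m)dv^2+\mathfrak b\,du\,dv+\mathfrak c\,du^2=0$, and all its coefficients vanish at $q$.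 When the tangential direction is spacelike or timelike, the coordinates $(u,v)$ can be chosen so that $E(q)\neq0$, and then the multiplicity is $$m_u({\rm p})=\dim_{\mathbb C}\mathcal O_2/\langle\mathfrak b,\mathfrak c\rangle,$$ where $\mathcal O_2$ is the ring of germs (at $q$) of holomorphic functions in two variables and $\mathfrak b,\mathfrak c$ are complexified. *)

theory Defs
  imports
    "HOL-Analysis.Analysis"
    "HOL-Algebra.Embedded_Algebras"
    "HOL-Algebra.QuotRing"
    "HOL-Library.Extended_Nat"
begin

section \<open>Minkowski 3-space\<close>

text \<open>The coordinates $u_0, u_1, u_2$ are the components \<open>$1\<close>, \<open>$2\<close>, \<open>$3\<close>.\<close>

definition lprod :: "real^3 \<Rightarrow> real^3 \<Rightarrow> real" where
  "lprod u v = u $ 1 * v $ 1 + u $ 2 * v $ 2 - u $ 3 * v $ 3"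

definition spacelike :: "real^3 \<Rightarrow> bool" where
  "spacelike w \<longleftrightarrow> w \<noteq> 0 \<and> lprod w w > 0"

definition timelike :: "real^3 \<Rightarrow> bool" where
  "timelike w \<longleftrightarrow> w \<noteq> 0 \<and> lprod w w < 0"

definition lcross :: "real^3 \<Rightarrow> real^3 \<Rightarrow> real^3" where
  "lcross u v = vector
     [u $ 2 * v $ 3 - u $ 3 * v $ 2,
      u $ 3 * v $ 1 - u $ 1 * v $ 3,
      u $ 2 * v $ 1 - u $ 1 * v $ 2]"

lemma lprod_lcross: "lprod (lcross u v) w = det (vector [u, v, w] :: real^3^3)"
  by (simp add: lprod_def lcross_def det_3 algebra_simps)

lemma lcross_unique:
  assumes "\<And>w. lprod c w = det (vector [u, v, w] :: real^3^3)"
  shows "c = lcross u v"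
proof -
  have eq: "lprod c w = lprod (lcross u v) w" for w
    by (simp add: assms lprod_lcross)
  show ?thesis
    using eq[of "vector [1, 0, 0]"] eq[of "vector [0, 1, 0]"] eq[of "vector [0, 0, 1]"]
    by (simp add: lprod_def vec_eq_iff forall_3)
qed

section \<open>Smooth and analytic maps\<close>

primrec Ck_on :: "nat \<Rightarrow> ('a::real_normed_vector \<Rightarrow> 'b::real_normed_vector) \<Rightarrow> 'a set \<Rightarrow> bool" where
  "Ck_on 0 f S \<longleftrightarrow> continuous_on S f"
| "Ck_on (Suc k) f S \<longleftrightarrow>
     (\<forall>p\<in>S. f differentiable (at p)) \<and>
     (\<forall>w. Ck_on k (\<lambda>p. frechet_derivative f (at p) w) S)"

definition smooth_on :: "('a::real_normed_vector \<Rightarrow> 'b::real_normed_vector) \<Rightarrow> 'a set \<Rightarrow> bool" where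
  "smooth_on f S \<longleftrightarrow> (\<forall>k. Ck_on k f S)"

definition diffeo_germ ::
    "('a::real_normed_vector \<Rightarrow> 'b::real_normed_vector) \<Rightarrow> 'a \<Rightarrow> 'b \<Rightarrow> bool" where
  "diffeo_germ f a b \<longleftrightarrow> f a = b \<and>
     (\<exists>U V g. open U \<and> a \<in> U \<and> open V \<and> b \<in> V \<and>
        homeomorphism U V f g \<and> smooth_on f U \<and> smooth_on g V)"

text \<open>Being given near \<open>z\<close> by a convergent power series in two variables: for
  \<open>'a = real\<close> this is real analyticity at \<open>z\<close>, for \<open>'a = complex\<close> it is being
  holomorphic in a neighbourhood of \<open>z\<close>.\<close>

definition analytic2_at ::
    "('a \<times> 'a \<Rightarrow> 'a::{real_normed_field,banach}) \<Rightarrow> 'a \<times> 'a \<Rightarrow> bool" where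
  "analytic2_at f z \<longleftrightarrow> (\<exists>a :: nat \<Rightarrow> nat \<Rightarrow> 'a. \<exists>r>0. \<forall>s t. norm s < r \<longrightarrow> norm t < r \<longrightarrow>
     ((\<lambda>(i, j). a i j * s ^ i * t ^ j) has_sum f (fst z + s, snd z + t)) UNIV)"

section \<open>Cross-caps\<close>

definition cross_cap_map :: "real \<times> real \<Rightarrow> real^3" where
  "cross_cap_map = (\<lambda>(s, t). vector [s, s * t, t\<^sup>2])"

definition cross_cap_germ :: "(real \<times> real \<Rightarrow> real^3) \<Rightarrow> real \<times> real \<Rightarrow> bool" where
  "cross_cap_germ x q \<longleftrightarrow> (\<exists>\<phi> \<Psi>. diffeo_germ \<phi> q (0, 0) \<and> diffeo_germ \<Psi> (x q) 0 \<and>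
     (\<forall>\<^sub>F z in nhds q. \<Psi> (x z) = cross_cap_map (\<phi> z)))"

text \<open>The set germ of \<open>M\<close> at \<open>p\<close> is the image of the map germ of \<open>x\<close> at \<open>q\<close>; all
  sufficiently small representatives of the map germ have to give this image.\<close>

definition parametrises_at ::
    "(real \<times> real \<Rightarrow> real^3) \<Rightarrow> real \<times> real \<Rightarrow> (real^3) set \<Rightarrow> real^3 \<Rightarrow> bool" where
  "parametrises_at x q M p \<longleftrightarrow> x q = p \<and>
     (\<exists>U. open U \<and> q \<in> U \<and>
        (\<forall>U'. open U' \<and> q \<in> U' \<and> U' \<subseteq> U \<longrightarrow>
           (\<exists>W. open W \<and> p \<in> W \<and> M \<inter> W = x ` U' \<inter> W)))"

text \<open>\<open>(x, q)\<close> is an analytic parametrisation which exhibits \<open>M\<close> as an analytic surface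
  with a cross-cap singularity at \<open>p\<close>.\<close>

definition analytic_cross_cap ::
    "(real \<times> real \<Rightarrow> real^3) \<Rightarrow> real \<times> real \<Rightarrow> (real^3) set \<Rightarrow> real^3 \<Rightarrow> bool" where
  "analytic_cross_cap x q M p \<longleftrightarrow> parametrises_at x q M p \<and>
     (\<forall>i. analytic2_at (\<lambda>z. x z $ i) q) \<and> cross_cap_germ x q"

definition tangential_direction :: "(real \<times> real \<Rightarrow> real^3) \<Rightarrow> real \<times> real \<Rightarrow> (real^3) set" where
  "tangential_direction x q = range (frechet_derivative x (at q))"

definition spacelike_direction :: "(real^3) set \<Rightarrow> bool" where
  "spacelike_direction L \<longleftrightarrow> (\<forall>w\<in>L. w \<noteq> 0 \<longrightarrow> spacelike w)"

definition timelike_direction :: "(real^3) set \<Rightarrow> bool" where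
  "timelike_direction L \<longleftrightarrow> (\<forall>w\<in>L. w \<noteq> 0 \<longrightarrow> timelike w)"

section \<open>Coefficients of the equation of the lines of principal curvature\<close>

definition d_u :: "(real \<times> real \<Rightarrow> real^3) \<Rightarrow> real \<times> real \<Rightarrow> real^3" where
  "d_u x = (\<lambda>z. frechet_derivative x (at z) (1, 0))"

definition d_v :: "(real \<times> real \<Rightarrow> real^3) \<Rightarrow> real \<times> real \<Rightarrow> real^3" where
  "d_v x = (\<lambda>z. frechet_derivative x (at z) (0, 1))"

definition coeff_E :: "(real \<times> real \<Rightarrow> real^3) \<Rightarrow> real \<times> real \<Rightarrow> real" where
  "coeff_E x z = lprod (d_u x z) (d_u x z)"

definition coeff_F :: "(real \<times> real \<Rightarrow> real^3) \<Rightarrow> real \<times> real \<Rightarrow> real" where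
  "coeff_F x z = lprod (d_u x z) (d_v x z)"

definition coeff_G :: "(real \<times> real \<Rightarrow> real^3) \<Rightarrow> real \<times> real \<Rightarrow> real" where
  "coeff_G x z = lprod (d_v x z) (d_v x z)"

definition coeff_l :: "(real \<times> real \<Rightarrow> real^3) \<Rightarrow> real \<times> real \<Rightarrow> real" where
  "coeff_l x z = lprod (lcross (d_u x z) (d_v x z)) (d_u (d_u x) z)"

definition coeff_m :: "(real \<times> real \<Rightarrow> real^3) \<Rightarrow> real \<times> real \<Rightarrow> real" where
  "coeff_m x z = lprod (lcross (d_u x z) (d_v x z)) (d_v (d_u x) z)"

definition coeff_n :: "(real \<times> real \<Rightarrow> real^3) \<Rightarrow> real \<times> real \<Rightarrow> real" where
  "coeff_n x z = lprod (lcross (d_u x z) (d_v x z)) (d_v (d_v x) z)"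

definition coeff_b :: "(real \<times> real \<Rightarrow> real^3) \<Rightarrow> real \<times> real \<Rightarrow> real" where
  "coeff_b x z = coeff_E x z * coeff_n x z - coeff_G x z * coeff_l x z"

definition coeff_c :: "(real \<times> real \<Rightarrow> real^3) \<Rightarrow> real \<times> real \<Rightarrow> real" where
  "coeff_c x z = coeff_E x z * coeff_m x z - coeff_F x z * coeff_l x z"

section \<open>Germs of holomorphic functions and the multiplicity\<close>

type_synonym cfun2 = "complex \<times> complex \<Rightarrow> complex"

definition germ :: "complex \<times> complex \<Rightarrow> cfun2 \<Rightarrow> cfun2 set" where
  "germ z f = {g. \<forall>\<^sub>F w in nhds z. g w = f w}"

definition O2 :: "complex \<times> complex \<Rightarrow> cfun2 set ring" where
  "O2 z = \<lparr>
     carrier = {germ z f | f. analytic2_at f z},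
     mult = (\<lambda>X Y. {h. \<exists>f\<in>X. \<exists>g\<in>Y. \<forall>\<^sub>F w in nhds z. h w = f w * g w}),
     one = germ z (\<lambda>_. 1),
     zero = germ z (\<lambda>_. 0),
     add = (\<lambda>X Y. {h. \<exists>f\<in>X. \<exists>g\<in>Y. \<forall>\<^sub>F w in nhds z. h w = f w + g w})\<rparr>"

definition complex_point :: "real \<times> real \<Rightarrow> complex \<times> complex" where
  "complex_point z = (complex_of_real (fst z), complex_of_real (snd z))"

text \<open>The holomorphic functions extending the real function \<open>f\<close> near \<open>q\<close>. For \<open>f\<close> analytic
  at \<open>q\<close> this set is one germ, by the identity theorem.\<close>

definition complexified_germ :: "(real \<times> real \<Rightarrow> real) \<Rightarrow> real \<times> real \<Rightarrow> cfun2 set" where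
  "complexified_germ f q =
     {h. analytic2_at h (complex_point q) \<and>
         (\<forall>\<^sub>F z in nhds q. h (complex_point z) = complex_of_real (f z))}"

definition ideal_bc :: "(real \<times> real \<Rightarrow> real^3) \<Rightarrow> real \<times> real \<Rightarrow> cfun2 set set" where
  "ideal_bc x q = genideal (O2 (complex_point q))
     {complexified_germ (coeff_b x) q, complexified_germ (coeff_c x) q}"

definition local_algebra :: "(real \<times> real \<Rightarrow> real^3) \<Rightarrow> real \<times> real \<Rightarrow> cfun2 set set ring" where
  "local_algebra x q = O2 (complex_point q) Quot ideal_bc x q"

text \<open>The complex scalars inside the local algebra: the residue classes of the constants.\<close>

definition scalars :: "(real \<times> real \<Rightarrow> real^3) \<Rightarrow> real \<times> real \<Rightarrow> cfun2 set set set" where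
  "scalars x q = range (\<lambda>k::complex.
     ideal_bc x q +>\<^bsub>O2 (complex_point q)\<^esub> germ (complex_point q) (\<lambda>_. k))"

text \<open>The multiplicity computed in the coordinates \<open>x\<close>; these are meant to satisfy
  \<open>coeff_E x q \<noteq> 0\<close>.\<close>

definition m_u :: "(real \<times> real \<Rightarrow> real^3) \<Rightarrow> real \<times> real \<Rightarrow> enat" where
  "m_u x q =
     (if ring.finite_dimension (local_algebra x q) (scalars x q) (carrier (local_algebra x q))
      then enat (ring.dim (local_algebra x q) (scalars x q) (carrier (local_algebra x q)))
      else \<infinity>)"

end

theory Submission
  imports Defs "HOL-Computational_Algebra.Formal_Power_Series"
begin

text \<open>Write \<open>A\<close> for the value of \<open>x_u\<close> at \<open>q\<close>. The derivative of a cross-cap at its singular point has rank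
  one, so \<open>A \<noteq> 0\<close> forces \<open>x_v = \<mu> A\<close> at \<open>q\<close>, and \<open>(- \<mu>, 1)\<close> spans the kernel. Put
  \<open>P = x_uv - \<mu> x_uu\<close> and \<open>Q = x_vv - \<mu> x_uv\<close>, the derivatives at \<open>q\<close> of the vector field
  \<open>x_v - \<mu> x_u\<close>, which vanishes there. By Whitney's criterion the triple product
  \<open>D = det (A, P, Q)\<close> is not zero. This is read off from the normal form
  \<open>\<Psi> \<circ> x = (s, s t, t\<^sup>2) \<circ> \<phi>\<close> in \<open>cross_cap_germ_nondegenerate\<close>: as \<open>x_v - \<mu> x_u\<close> vanishes at
  \<open>q\<close>, the second derivative of \<open>\<Psi>\<close> does not enter, and \<open>D\<close> is a non-zero multiple of the
  determinant belonging to the normal form.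

  The normal \<open>x_u \<times> x_v\<close> vanishes at \<open>q\<close> and has the partial derivatives \<open>A \<times> P\<close> and \<open>A \<times> Q\<close>
  there. Hence \<open>l\<close>, \<open>m\<close>, \<open>n\<close> vanish at \<open>q\<close>, and their differentials there contain no third
  derivatives of \<open>x\<close>. Since \<open>F = \<mu> E\<close> and \<open>G = \<mu>\<^sup>2 E\<close> at \<open>q\<close>, the differentials of \<open>b = E n - G l\<close> and
  \<open>c = E m - F l\<close> are combinations of triple products, and by \<open>jacobian_identities\<close> the Jacobian
  determinant of \<open>(b, c)\<close> at \<open>q\<close> is \<open>- (E D)\<^sup>2\<close>, which is not zero if \<open>E\<close> is not.

  Two holomorphic germs which vanish at a point and have independent differentials there generate
  the maximal ideal (\<open>genideal_eq_maximal_germs\<close>): write \<open>b = s b1 + t b2\<close> and \<open>c = s c1 + t c2\<close>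
  and solve for the coordinates \<open>s\<close>, \<open>t\<close> by Cramer's rule, the determinant being a unit. So the
  local algebra is the residue field, which consists of the classes of the constants and has
  dimension one over them (\<open>dim_residue_field\<close>).

  All analytic functions are handled through their double power series. A series is represented by
  a formal series in the first variable whose coefficients are formal series in the second one.
  In this form partial derivatives are formal, complexification is the embedding of the
  coefficients, and the identity theorem shows that a real analytic germ has only one
  complexification.

  Finally, a parametrisation with \<open>E \<noteq> 0\<close> exists: one of \<open>x_u\<close>, \<open>x_v\<close> is not zero at \<open>q\<close>, it spans
  the tangential direction and is therefore not lightlike; if necessary, the two coordinates are
  interchanged.\<close>

section \<open>Convergent double power series\<close>

abbreviation coeff2 :: "'a::zero fps fps \<Rightarrow> nat \<Rightarrow> nat \<Rightarrow> 'a" where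
  "coeff2 A i j \<equiv> fps_nth (fps_nth A i) j"

lemma coeff2_eqI: "(\<And>i j. coeff2 A i j = coeff2 B i j) \<Longrightarrow> A = B"
  by (simp add: fps_ext)

lemma coeff2_mult: "coeff2 (A * B) i j = (\<Sum>k\<le>i. \<Sum>l\<le>j. coeff2 A k l * coeff2 B (i - k) (j - l))"
  by (simp add: fps_mult_nth fps_sum_nth atMost_atLeast0)

definition series_term ::
    "'a::real_normed_field fps fps \<Rightarrow> 'a \<times> 'a \<Rightarrow> nat \<times> nat \<Rightarrow> 'a" where
  "series_term A h = (\<lambda>(i, j). coeff2 A i j * fst h ^ i * snd h ^ j)"

text \<open>The coefficients form a formal power series in the first variable over the formal power series in
  the second one, so that their ring structure is that of \<open>'a fps fps\<close>. Only the germ of \<open>f\<close> at \<open>z\<close> is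
  constrained, and no radius of convergence is fixed.\<close>

definition has_series ::
    "('a \<times> 'a \<Rightarrow> 'a) \<Rightarrow> 'a \<times> 'a \<Rightarrow> 'a::{real_normed_field,banach} fps fps \<Rightarrow> bool" where
  "has_series f z A \<longleftrightarrow> (\<forall>\<^sub>F w in nhds z. (series_term A (w - z) has_sum f w) UNIV)"

text \<open>Geometric growth of the coefficients is equivalent to convergence in some polydisc
  (\<open>has_series_convergent2\<close> and \<open>convergent2_has_series\<close>), and it is the form in which convergence
  is inherited by shifted, differentiated and inverted series.\<close>

definition convergent2 :: "'a::real_normed_field fps fps \<Rightarrow> bool" where
  "convergent2 A \<longleftrightarrow> (\<exists>C K. C > 0 \<and> K > 0 \<and> (\<forall>i j. norm (coeff2 A i j) \<le> C * K ^ (i + j)))"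

text \<open>This passes between polydiscs, which domains of convergence of power series contain, and the
  neighbourhood filter, with which several such domains are intersected without naming radii.\<close>

lemma eventually_nhds_prod_norm:
  fixes z :: "'a::real_normed_vector \<times> 'b::real_normed_vector"
  shows "eventually P (nhds z) \<longleftrightarrow>
    (\<exists>r>0. \<forall>s t. norm s < r \<longrightarrow> norm t < r \<longrightarrow> P (fst z + s, snd z + t))"
proof
  assume "eventually P (nhds z)"
  then obtain e where e: "e > 0" "\<And>w. dist w z < e \<Longrightarrow> P w"
    unfolding eventually_nhds_metric by blast
  have "P (fst z + s, snd z + t)" if "norm s < e / 2" "norm t < e / 2" for s t
  proof (rule e(2))
    have "dist (fst z + s, snd z + t) z = norm (s, t)"
      by (cases z) (simp add: dist_norm)
    also have "\<dots> \<le> norm s + norm t" by (rule norm_Pair_le)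
    finally show "dist (fst z + s, snd z + t) z < e" using that by linarith
  qed
  then show "\<exists>r>0. \<forall>s t. norm s < r \<longrightarrow> norm t < r \<longrightarrow> P (fst z + s, snd z + t)"
    using e(1) half_gt_zero by blast
next
  assume "\<exists>r>0. \<forall>s t. norm s < r \<longrightarrow> norm t < r \<longrightarrow> P (fst z + s, snd z + t)"
  then obtain r where r: "r > 0" "\<And>s t. norm s < r \<Longrightarrow> norm t < r \<Longrightarrow> P (fst z + s, snd z + t)"
    by blast
  have "P w" if "dist w z < r" for w
  proof -
    have "norm (fst (w - z)) < r" "norm (snd (w - z)) < r"
      using that norm_fst_le[of "fst (w - z)" "snd (w - z)"] norm_snd_le[of "snd (w - z)" "fst (w - z)"]
      unfolding dist_norm prod.collapse by linarith+
    from r(2)[OF this] show ?thesis by (cases w, cases z) simp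
  qed
  then show "eventually P (nhds z)"
    unfolding eventually_nhds_metric using r(1) by blast
qed

lemma analytic2_at_iff_has_series: "analytic2_at f z \<longleftrightarrow> (\<exists>A. has_series f z A)"
proof
  assume "analytic2_at f z"
  then obtain a r where r: "r > 0" and s: "\<And>s t. norm s < r \<Longrightarrow> norm t < r \<Longrightarrow>
     ((\<lambda>(i, j). a i j * s ^ i * t ^ j) has_sum f (fst z + s, snd z + t)) UNIV"
    unfolding analytic2_at_def by blast
  have "has_series f z (Abs_fps (\<lambda>i. Abs_fps (a i)))"
    unfolding has_series_def eventually_nhds_prod_norm series_term_def
    using r s by auto
  then show "\<exists>A. has_series f z A" by blast
next
  assume "\<exists>A. has_series f z A"
  then obtain A r where "r > 0" "\<And>s t. norm s < r \<Longrightarrow> norm t < r \<Longrightarrow>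
     (series_term A ((fst z + s, snd z + t) - z) has_sum f (fst z + s, snd z + t)) UNIV"
    unfolding has_series_def eventually_nhds_prod_norm by blast
  then show "analytic2_at f z"
    unfolding analytic2_at_def series_term_def
    by (intro exI[of _ "coeff2 A"] exI[of _ r]) auto
qed

lemma has_series_cong:
  "\<forall>\<^sub>F w in nhds z. f w = g w \<Longrightarrow> has_series f z A \<longleftrightarrow> has_series g z A"
  unfolding has_series_def by (rule eventually_cong[of "\<lambda>w. f w = g w"]) auto

text \<open>The terms of a convergent series at a point \<open>(\<rho>, \<rho>)\<close> with \<open>\<rho> \<noteq> 0\<close> are bounded.\<close>

lemma has_series_convergent2:
  assumes "has_series f z A"
  shows "convergent2 A"
proof -
  obtain r where r: "r > 0" and *: "\<And>s t. norm s < r \<Longrightarrow> norm t < r \<Longrightarrow>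
     (series_term A ((fst z + s, snd z + t) - z) has_sum f (fst z + s, snd z + t)) UNIV"
    using assms unfolding has_series_def eventually_nhds_prod_norm by blast
  define \<rho> :: 'a where "\<rho> = of_real (r / 2)"
  have n\<rho>: "norm \<rho> = r / 2" using r by (simp add: \<rho>_def)
  have "series_term A (\<rho>, \<rho>) summable_on UNIV"
    using *[of \<rho> \<rho>] r n\<rho> by (cases z) (auto simp: summable_on_def)
  then have "(\<lambda>n. series_term A (\<rho>, \<rho>) (prod_decode n)) summable_on UNIV"
    using summable_on_reindex_bij_betw[OF bij_prod_decode] by blast
  then have "(\<lambda>n. series_term A (\<rho>, \<rho>) (prod_decode n)) \<longlonglongrightarrow> 0"
    by (intro summable_LIMSEQ_zero summable_on_imp_summable)
  then have "Bseq (\<lambda>n. series_term A (\<rho>, \<rho>) (prod_decode n))"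
    by (intro convergent_imp_Bseq convergentI)
  then obtain C where C: "C > 0" "\<And>n. norm (series_term A (\<rho>, \<rho>) (prod_decode n)) \<le> C"
    by (auto elim!: BseqE)
  have "norm (coeff2 A i j) \<le> C * (2 / r) ^ (i + j)" for i j
  proof -
    have "norm (series_term A (\<rho>, \<rho>) (i, j)) \<le> C"
      using C(2)[of "prod_encode (i, j)"] by simp
    then have "norm (coeff2 A i j) * (r / 2) ^ (i + j) \<le> C"
      by (simp add: series_term_def norm_mult norm_power n\<rho> power_add mult_ac)
    then show ?thesis using r by (simp add: field_simps power_divide)
  qed
  then show ?thesis
    unfolding convergent2_def using C(1) r by (intro exI[of _ C] exI[of _ "2 / r"]) auto
qed

lemma summable_on_geometric_product:
  assumes "norm x < 1" "norm y < 1"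
  shows "(\<lambda>(i::nat, j::nat). norm x ^ i * norm y ^ j) summable_on UNIV"
proof -
  have hs: "((\<lambda>i. norm x ^ i) has_sum (1 / (1 - norm x))) UNIV"
           "((\<lambda>i. norm y ^ i) has_sum (1 / (1 - norm y))) UNIV"
    using geometric_sums[of "norm x"] geometric_sums[of "norm y"] assms
    by (auto intro!: norm_summable_imp_has_sum summable_geometric)
  have "(\<lambda>(i::nat, j::nat). norm x ^ i * norm y ^ j) summable_on (UNIV \<times> UNIV)"
  proof (rule summable_on_SigmaI)
    show "((\<lambda>j. case (i, j) of (i, j) \<Rightarrow> norm x ^ i * norm y ^ j)
            has_sum (norm x ^ i * (1 / (1 - norm y)))) UNIV" for i :: nat
      using has_sum_cmult_right[OF hs(2)] by simp
    show "(\<lambda>i. norm x ^ i * (1 / (1 - norm y))) summable_on UNIV"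
      by (rule summable_on_cmult_left[OF has_sum_imp_summable[OF hs(1)]])
  qed auto
  then show ?thesis by simp
qed

lemma convergent2_summable_majorant:
  assumes "convergent2 A"
  obtains r where "r > 0" "(\<lambda>(i, j). norm (coeff2 A i j) * r ^ i * r ^ j) summable_on UNIV"
proof -
  obtain C K where K: "K > 0" and CK: "\<And>i j. norm (coeff2 A i j) \<le> C * K ^ (i + j)"
    using assms unfolding convergent2_def by blast
  have "(\<lambda>(i::nat, j::nat). C * (norm (1/2::real) ^ i * norm (1/2::real) ^ j)) summable_on UNIV"
    using summable_on_cmult_right[OF summable_on_geometric_product[of "1/2 :: real" "1/2 :: real"], of C]
    by (simp add: case_prod_unfold)
  then have "(\<lambda>(i, j). norm (coeff2 A i j) * (1 / (2 * K)) ^ i * (1 / (2 * K)) ^ j) summable_on UNIV"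
  proof (rule summable_on_comparison_test)
    fix p :: "nat \<times> nat"
    obtain i j where p: "p = (i, j)" by force
    have "norm (coeff2 A i j) * (1 / (2 * K)) ^ i * (1 / (2 * K)) ^ j
      \<le> C * K ^ (i + j) * (1 / (2 * K)) ^ i * (1 / (2 * K)) ^ j"
      using K by (intro mult_right_mono CK) auto
    also have "\<dots> = C * (norm (1/2::real) ^ i * norm (1/2::real) ^ j)"
      using K by (simp add: power_add field_simps power_divide power_mult_distrib)
    finally show "(case p of (i, j) \<Rightarrow> norm (coeff2 A i j) * (1 / (2 * K)) ^ i * (1 / (2 * K)) ^ j)
      \<le> (case p of (i, j) \<Rightarrow> C * (norm (1/2::real) ^ i * norm (1/2::real) ^ j))"
      by (simp add: p)
    show "0 \<le> (case p of (i, j) \<Rightarrow> norm (coeff2 A i j) * (1 / (2 * K)) ^ i * (1 / (2 * K)) ^ j)"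
      using K by (simp add: p)
  qed
  with K show ?thesis by (intro that[of "1 / (2 * K)"]) auto
qed

lemma norm_series_term_le:
  assumes "norm (fst h) \<le> r" "norm (snd h) \<le> r"
  shows "norm (series_term A h p) \<le> (case p of (i, j) \<Rightarrow> norm (coeff2 A i j) * r ^ i * r ^ j)"
proof -
  have "0 \<le> r" using assms(1) norm_ge_zero order_trans by blast
  then show ?thesis
    using assms by (auto simp: series_term_def norm_mult norm_power split: prod.splits
        intro!: mult_mono power_mono)
qed

lemma convergent2_abs_summable:
  assumes "convergent2 A"
  shows "\<forall>\<^sub>F w in nhds z. (\<lambda>p. norm (series_term A (w - z) p)) summable_on UNIV"
proof -
  obtain r where r: "r > 0" "(\<lambda>(i, j). norm (coeff2 A i j) * r ^ i * r ^ j) summable_on UNIV"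
    using convergent2_summable_majorant[OF assms] .
  have "(\<lambda>p. norm (series_term A (s, t) p)) summable_on UNIV" if "norm s < r" "norm t < r" for s t
    by (rule Infinite_Sum.abs_summable_on_comparison_test'[OF r(2)])
       (use that norm_series_term_le[of "(s, t)" r A] in auto)
  then show ?thesis
    unfolding eventually_nhds_prod_norm using r(1) by (intro exI[of _ r]) (cases z, auto)
qed

lemma convergent2_has_series:
  assumes "convergent2 A"
  shows "has_series (\<lambda>w. infsum (series_term A (w - z)) UNIV) z A"
  unfolding has_series_def
  using convergent2_abs_summable[OF assms] by eventually_elim (simp add: abs_summable_summable)

lemma has_series_abs_summable:
  assumes "has_series f z A"
  shows "\<forall>\<^sub>F w in nhds z. (\<lambda>p. norm (series_term A (w - z) p)) summable_on UNIV"
  using convergent2_abs_summable has_series_convergent2 assms by blast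

lemma has_series_at_center: "has_series f z A \<Longrightarrow> f z = coeff2 A 0 0"
proof -
  assume "has_series f z A"
  then have "(series_term A (z - z) has_sum f z) UNIV"
    unfolding has_series_def by (rule eventually_nhds_x_imp_x)
  moreover have "(series_term A (z - z) has_sum coeff2 A 0 0) UNIV"
    by (rule has_sum_finite_neutralI[of "{(0, 0)}"])
       (auto simp: series_term_def zero_power split: if_splits)
  ultimately show ?thesis by (rule has_sum_unique)
qed

lemma has_series_add:
  assumes "has_series f z A" "has_series g z B"
  shows "has_series (\<lambda>w. f w + g w) z (A + B)"
  using assms unfolding has_series_def
proof eventually_elim
  case (elim w)
  have "series_term (A + B) (w - z) = (\<lambda>p. series_term A (w - z) p + series_term B (w - z) p)"
    by (auto simp: series_term_def algebra_simps)
  with has_sum_add[OF elim] show ?case by simp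
qed

lemma has_series_uminus:
  assumes "has_series f z A"
  shows "has_series (\<lambda>w. - f w) z (- A)"
  using assms unfolding has_series_def
proof eventually_elim
  case (elim w)
  have "series_term (- A) (w - z) = (\<lambda>p. - series_term A (w - z) p)"
    by (auto simp: series_term_def)
  with elim show ?case by (simp add: has_sum_uminus)
qed

lemma has_series_diff:
  assumes "has_series f z A" "has_series g z B"
  shows "has_series (\<lambda>w. f w - g w) z (A - B)"
  using has_series_add[OF assms(1) has_series_uminus[OF assms(2)]] by simp

lemma has_sum_prod_abs:
  fixes f :: "'b \<Rightarrow> 'a::{real_normed_field,banach}" and g :: "'c \<Rightarrow> 'a"
  assumes "(\<lambda>x. norm (f x)) summable_on X" "(\<lambda>y. norm (g y)) summable_on Y" "(f has_sum a) X" "(g has_sum b) Y"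
  shows "((\<lambda>(x, y). f x * g y) has_sum (a * b)) (X \<times> Y)"
proof (rule has_sum_SigmaI)
  show "((\<lambda>y. case (x, y) of (x, y) \<Rightarrow> f x * g y) has_sum (f x * b)) Y" for x
    using has_sum_cmult_right[OF assms(4)] by simp
  show "((\<lambda>x. f x * b) has_sum a * b) X" by (rule has_sum_cmult_left[OF assms(3)])
  have "(\<lambda>(x, y). norm (f x) * norm (g y)) summable_on (X \<times> Y)"
  proof (rule summable_on_SigmaI)
    show "((\<lambda>y. case (x, y) of (x, y) \<Rightarrow> norm (f x) * norm (g y))
             has_sum (norm (f x) * infsum (\<lambda>y. norm (g y)) Y)) Y" for x
      using has_sum_cmult_right[OF has_sum_infsum[OF assms(2)]] by simp
    show "(\<lambda>x. norm (f x) * infsum (\<lambda>y. norm (g y)) Y) summable_on X"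
      by (rule summable_on_cmult_left[OF assms(1)])
  qed auto
  then have "(\<lambda>p. norm ((\<lambda>(x, y). f x * g y) p)) summable_on (X \<times> Y)"
    by (simp add: case_prod_unfold norm_mult)
  then show "(\<lambda>(x, y). f x * g y) summable_on (X \<times> Y)" by (rule abs_summable_summable)
qed

text \<open>Cauchy product: the absolutely convergent product family, indexed by pairs of exponents
  \<open>(q, q')\<close>, is reindexed by \<open>(q + q', q)\<close> and summed over the finitely many \<open>q\<close> first.\<close>

lemma has_series_mult:
  assumes f: "has_series f z A" and g: "has_series g z B"
  shows "has_series (\<lambda>w. f w * g w) z (A * B)"
  using f[unfolded has_series_def] g[unfolded has_series_def]
    has_series_abs_summable[OF f] has_series_abs_summable[OF g]
  unfolding has_series_def
proof eventually_elim
  case (elim w)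
  define h where "h = w - z"
  let ?D = "SIGMA p:UNIV. {..fst p} \<times> {..snd p :: nat} :: ((nat \<times> nat) \<times> (nat \<times> nat)) set"
  let ?F = "\<lambda>(p, q). coeff2 A (fst q) (snd q) * coeff2 B (fst p - fst q) (snd p - snd q)
               * fst h ^ fst p * snd h ^ snd p"
  have "((\<lambda>(p, q). series_term A h p * series_term B h q) has_sum (f w * g w)) (UNIV \<times> UNIV)"
    using elim by (intro has_sum_prod_abs) (auto simp: h_def)
  also have "?this \<longleftrightarrow> (?F has_sum (f w * g w)) ?D"
    by (rule has_sum_reindex_bij_witness[of _
          "\<lambda>(p, q). (q, (fst p - fst q, snd p - snd q))"
          "\<lambda>(p, q). ((fst p + fst q, snd p + snd q), p)"])
       (auto simp: series_term_def power_add mult_ac)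
  finally have *: "(?F has_sum (f w * g w)) ?D" .
  have "((\<lambda>p. \<Sum>q\<in>{..fst p} \<times> {..snd p}. ?F (p, q)) has_sum (f w * g w)) UNIV"
    by (rule has_sum_SigmaD[OF *]) (auto intro!: has_sum_finite)
  also have "(\<lambda>p. \<Sum>q\<in>{..fst p} \<times> {..snd p}. ?F (p, q)) = series_term (A * B) h"
    by (auto simp: series_term_def coeff2_mult sum.cartesian_product sum_distrib_right
          case_prod_unfold fun_eq_iff)
  finally show ?case by (simp add: h_def)
qed

definition series_const :: "'a::zero \<Rightarrow> 'a fps fps" where
  "series_const c = fps_const (fps_const c)"

lemma coeff2_series_const [simp]: "coeff2 (series_const c) i j = (if i = 0 \<and> j = 0 then c else 0)"
  by (auto simp: series_const_def)

lemma has_series_const: "has_series (\<lambda>_. c) z (series_const c)"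
  unfolding has_series_def
  by (intro always_eventually allI has_sum_finite_neutralI[of "{(0, 0)}"])
     (auto simp: series_term_def split: if_splits)

abbreviation series_s :: "'a::real_normed_field fps fps" where
  "series_s \<equiv> fps_X"

abbreviation series_t :: "'a::real_normed_field fps fps" where
  "series_t \<equiv> fps_const fps_X"

lemma has_series_s: "has_series (\<lambda>w. fst w - fst z) z series_s"
  unfolding has_series_def
  by (intro always_eventually allI has_sum_finite_neutralI[of "{(1, 0)}"])
     (auto simp: series_term_def fps_X_def split: if_splits)

lemma has_series_t: "has_series (\<lambda>w. snd w - snd z) z series_t"
  unfolding has_series_def
  by (intro always_eventually allI has_sum_finite_neutralI[of "{(0, 1)}"])
     (auto simp: series_term_def fps_X_def split: if_splits)

section \<open>Differentiation of double power series and the identity theorem\<close>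

lemma has_series_eq:
  assumes "has_series f z A" "has_series g z A"
  shows "\<forall>\<^sub>F w in nhds z. f w = g w"
  using assms unfolding has_series_def by eventually_elim (rule has_sum_unique)

definition series_ds :: "'a::real_normed_field fps fps \<Rightarrow> 'a fps fps" where
  "series_ds A = Abs_fps (\<lambda>i. Abs_fps (\<lambda>j. of_nat (Suc i) * coeff2 A (Suc i) j))"

definition series_dt :: "'a::real_normed_field fps fps \<Rightarrow> 'a fps fps" where
  "series_dt A = Abs_fps (\<lambda>i. Abs_fps (\<lambda>j. of_nat (Suc j) * coeff2 A i (Suc j)))"

lemma coeff2_series_ds [simp]: "coeff2 (series_ds A) i j = of_nat (Suc i) * coeff2 A (Suc i) j"
  by (simp add: series_ds_def del: of_nat_Suc)

lemma coeff2_series_dt [simp]: "coeff2 (series_dt A) i j = of_nat (Suc j) * coeff2 A i (Suc j)"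
  by (simp add: series_dt_def del: of_nat_Suc)

lemma convergent2I:
  assumes "\<And>i j. norm (coeff2 A i j) \<le> C * K ^ (i + j)" "C > 0" "K > 0"
  shows "convergent2 A"
  using assms unfolding convergent2_def by blast

lemma Suc_le_power2: "real (Suc i) \<le> 2 ^ (i + j)"
proof -
  have "Suc i \<le> 2 ^ i" by (induction i) auto
  then have "real (Suc i) \<le> 2 ^ i" by (metis of_nat_le_iff of_nat_numeral of_nat_power)
  also have "\<dots> \<le> 2 ^ (i + j)" by (rule power_increasing) auto
  finally show ?thesis .
qed

lemma convergent2_ds:
  assumes "convergent2 A" shows "convergent2 (series_ds A)"
proof -
  obtain C K where CK: "C > 0" "K > 0" "\<And>i j. norm (coeff2 A i j) \<le> C * K ^ (i + j)"
    using assms unfolding convergent2_def by blast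
  have "norm (coeff2 (series_ds A) i j) \<le> (C * K) * (2 * K) ^ (i + j)" for i j
  proof -
    have "norm (coeff2 (series_ds A) i j) = real (Suc i) * norm (coeff2 A (Suc i) j)"
      by (simp add: norm_mult del: of_nat_Suc)
    also have "\<dots> \<le> 2 ^ (i + j) * (C * K ^ (Suc i + j))"
      using CK by (intro mult_mono Suc_le_power2 CK(3)) auto
    finally show ?thesis by (simp add: power_mult_distrib mult_ac)
  qed
  then show ?thesis using CK by (intro convergent2I[of _ "C * K" "2 * K"]) auto
qed

lemma convergent2_dt:
  assumes "convergent2 A" shows "convergent2 (series_dt A)"
proof -
  obtain C K where CK: "C > 0" "K > 0" "\<And>i j. norm (coeff2 A i j) \<le> C * K ^ (i + j)"
    using assms unfolding convergent2_def by blast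
  have "norm (coeff2 (series_dt A) i j) \<le> (C * K) * (2 * K) ^ (i + j)" for i j
  proof -
    have "norm (coeff2 (series_dt A) i j) = real (Suc j) * norm (coeff2 A i (Suc j))"
      by (simp add: norm_mult del: of_nat_Suc)
    also have "\<dots> \<le> 2 ^ (j + i) * (C * K ^ (i + Suc j))"
      using CK by (intro mult_mono Suc_le_power2 CK(3)) auto
    finally show ?thesis by (simp add: power_mult_distrib mult_ac add_ac)
  qed
  then show ?thesis using CK by (intro convergent2I[of _ "C * K" "2 * K"]) auto
qed

lemma majorant_mono:
  assumes "(\<lambda>(i, j). norm (coeff2 A i j) * r ^ i * r ^ j) summable_on UNIV" "0 \<le> r'" "r' \<le> r"
  shows "(\<lambda>(i, j). norm (coeff2 A i j) * r' ^ i * r' ^ j) summable_on UNIV"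
  by (rule summable_on_comparison_test[OF assms(1)])
     (use assms(2,3) in \<open>auto intro!: mult_mono power_mono\<close>)

text \<open>Differentiation lowers an exponent. With the term \<open>0\<close> inserted at exponent \<open>0\<close>, the derivative of
  the term with exponents \<open>(i, j)\<close> again stands at the index \<open>(i, j)\<close>.\<close>

lemma has_sum_shift_fst:
  fixes g :: "nat \<times> nat \<Rightarrow> 'a::{topological_comm_monoid_add, t2_space}"
  assumes "(g has_sum S) UNIV"
  shows "((\<lambda>(i, j). if i = 0 then 0 else g (i - 1, j)) has_sum S) UNIV"
proof -
  have "(g has_sum S) UNIV \<longleftrightarrow>
    ((\<lambda>(i, j). if i = 0 then 0 else g (i - 1, j)) has_sum S) ({0<..} \<times> UNIV)"
    by (rule has_sum_reindex_bij_witness[of _ "\<lambda>(i, j). (i - 1, j)" "\<lambda>(i, j). (i + 1, j)"]) auto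
  also have "\<dots> \<longleftrightarrow> ((\<lambda>(i, j). if i = 0 then 0 else g (i - 1, j)) has_sum S) UNIV"
    by (rule has_sum_cong_neutral) (auto split: if_splits)
  finally show ?thesis using assms by simp
qed

lemma has_sum_shift_snd:
  fixes g :: "nat \<times> nat \<Rightarrow> 'a::{topological_comm_monoid_add, t2_space}"
  assumes "(g has_sum S) UNIV"
  shows "((\<lambda>(i, j). if j = 0 then 0 else g (i, j - 1)) has_sum S) UNIV"
proof -
  have "(g has_sum S) UNIV \<longleftrightarrow>
    ((\<lambda>(i, j). if j = 0 then 0 else g (i, j - 1)) has_sum S) (UNIV \<times> {0<..})"
    by (rule has_sum_reindex_bij_witness[of _ "\<lambda>(i, j). (i, j - 1)" "\<lambda>(i, j). (i, j + 1)"]) auto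
  also have "\<dots> \<longleftrightarrow> ((\<lambda>(i, j). if j = 0 then 0 else g (i, j - 1)) has_sum S) UNIV"
    by (rule has_sum_cong_neutral) (auto split: if_splits)
  finally show ?thesis using assms by simp
qed

lemma has_sum_prod_decode_sums:
  "(g has_sum S) UNIV \<Longrightarrow> (\<lambda>n. g (prod_decode n)) sums S"
  using has_sum_reindex_bij_betw[OF bij_prod_decode] has_sum_imp_sums by blast

text \<open>The Weierstrass test for double series, in the sequential form which differentiation term by
  term requires.\<close>

lemma uniform_limit_prod_decode:
  fixes F :: "'h \<Rightarrow> nat \<times> nat \<Rightarrow> 'a::banach"
  assumes M: "M summable_on UNIV"
    and le: "\<And>h p. h \<in> S \<Longrightarrow> norm (F h p) \<le> M p"
    and G: "\<And>h. h \<in> S \<Longrightarrow> (F h has_sum G h) UNIV"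
  shows "uniform_limit S (\<lambda>N h. \<Sum>n<N. F h (prod_decode n)) G sequentially"
proof -
  have "uniform_limit S (\<lambda>N h. \<Sum>n<N. F h (prod_decode n))
      (\<lambda>h. suminf (\<lambda>n. F h (prod_decode n))) sequentially"
    using le M summable_on_reindex_bij_betw[OF bij_prod_decode, of M]
    by (intro Weierstrass_m_test[where M = "\<lambda>n. M (prod_decode n)"] summable_on_imp_summable) auto
  also have "?this \<longleftrightarrow> ?thesis"
    using sums_unique[OF has_sum_prod_decode_sums[OF G]]
    by (intro uniform_limit_cong') auto
  finally show ?thesis .
qed

text \<open>Differentiation term by term. On a small polydisc the two formally differentiated series have
  summable majorants that do not depend on the point, so they converge uniformly there, and the
  derivative exists at every point of the polydisc and not only at its centre.\<close>

lemma has_series_has_derivative: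
  fixes f :: "'a \<times> 'a \<Rightarrow> 'a::{real_normed_field,banach}"
  assumes f: "has_series f z A"
  obtains P Q where "has_series P z (series_ds A)" "has_series Q z (series_dt A)"
    "\<forall>\<^sub>F w in nhds z. (f has_derivative (\<lambda>h. P w * fst h + Q w * snd h)) (at w)"
proof -
  have conv: "convergent2 (series_ds A)" "convergent2 (series_dt A)"
    using has_series_convergent2[OF f] by (simp_all add: convergent2_ds convergent2_dt)
  obtain r1 where r1: "r1 > 0"
     "(\<lambda>(i, j). norm (coeff2 (series_ds A) i j) * r1 ^ i * r1 ^ j) summable_on UNIV"
    using convergent2_summable_majorant[OF conv(1)] .
  obtain r2 where r2: "r2 > 0"
     "(\<lambda>(i, j). norm (coeff2 (series_dt A) i j) * r2 ^ i * r2 ^ j) summable_on UNIV"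
    using convergent2_summable_majorant[OF conv(2)] .
  obtain r0 where r0: "r0 > 0" and fsum: "\<And>s t. norm s < r0 \<Longrightarrow> norm t < r0 \<Longrightarrow>
     (series_term A ((fst z + s, snd z + t) - z) has_sum f (fst z + s, snd z + t)) UNIV"
    using f unfolding has_series_def eventually_nhds_prod_norm by blast
  define r where "r = min r0 (min r1 r2)"
  have r: "r > 0" "r \<le> r0" "r \<le> r1" "r \<le> r2" using r0 r1 r2 by (auto simp: r_def)
  define S :: "('a \<times> 'a) set" where "S = ball 0 r \<times> ball 0 r"
  have S: "open S" "convex S" "0 \<in> S"
    using r by (auto simp: S_def zero_prod_def intro: open_Times convex_Times)
  have S_iff: "h \<in> S \<longleftrightarrow> norm (fst h) < r \<and> norm (snd h) < r" for h
    by (cases h) (auto simp: S_def)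
  define MP where "MP = (\<lambda>(i, j). norm (coeff2 (series_ds A) i j) * r ^ i * r ^ j)"
  define MQ where "MQ = (\<lambda>(i, j). norm (coeff2 (series_dt A) i j) * r ^ i * r ^ j)"
  have MP: "MP summable_on UNIV" and MQ: "MQ summable_on UNIV"
    unfolding MP_def MQ_def by (rule majorant_mono[OF r1(2)] majorant_mono[OF r2(2)]; use r in simp)+
  define P where "P h = infsum (series_term (series_ds A) h) UNIV" for h
  define Q where "Q h = infsum (series_term (series_dt A) h) UNIV" for h
  have leP: "norm (series_term (series_ds A) h p) \<le> MP p"
    and leQ: "norm (series_term (series_dt A) h p) \<le> MQ p" if "h \<in> S" for h p
    unfolding MP_def MQ_def using that
    by (intro norm_series_term_le; simp add: S_iff less_imp_le)+
  have P: "(series_term (series_ds A) h has_sum P h) UNIV"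
    and Q: "(series_term (series_dt A) h has_sum Q h) UNIV" if "h \<in> S" for h
  proof -
    have "(\<lambda>p. norm (series_term (series_ds A) h p)) summable_on UNIV"
      by (rule Infinite_Sum.abs_summable_on_comparison_test'[OF MP]) (rule leP[OF that])
    then show "(series_term (series_ds A) h has_sum P h) UNIV"
      unfolding P_def by (rule has_sum_infsum[OF abs_summable_summable])
    have "(\<lambda>p. norm (series_term (series_dt A) h p)) summable_on UNIV"
      by (rule Infinite_Sum.abs_summable_on_comparison_test'[OF MQ]) (rule leQ[OF that])
    then show "(series_term (series_dt A) h has_sum Q h) UNIV"
      unfolding Q_def by (rule has_sum_infsum[OF abs_summable_summable])
  qed
  let ?fst = "\<lambda>g (i, j). if i = 0 then 0 else g (i - 1, j :: nat)"
  let ?snd = "\<lambda>g (i :: nat, j). if j = 0 then 0 else g (i, j - 1)"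
  define Pt where "Pt h = ?fst (series_term (series_ds A) h)" for h
  define Qt where "Qt h = ?snd (series_term (series_dt A) h)" for h
  have limP: "uniform_limit S (\<lambda>N h. \<Sum>n<N. Pt h (prod_decode n)) P sequentially"
  proof (rule uniform_limit_prod_decode)
    show "?fst MP summable_on UNIV"
      using has_sum_shift_fst[OF has_sum_infsum[OF MP]] by (rule has_sum_imp_summable)
    show "norm (Pt h p) \<le> ?fst MP p" if "h \<in> S" for h p
      using leP[OF that] by (auto simp: Pt_def split: prod.splits)
    show "(Pt h has_sum P h) UNIV" if "h \<in> S" for h
      unfolding Pt_def by (rule has_sum_shift_fst[OF P[OF that]])
  qed
  have limQ: "uniform_limit S (\<lambda>N h. \<Sum>n<N. Qt h (prod_decode n)) Q sequentially"
  proof (rule uniform_limit_prod_decode)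
    show "?snd MQ summable_on UNIV"
      using has_sum_shift_snd[OF has_sum_infsum[OF MQ]] by (rule has_sum_imp_summable)
    show "norm (Qt h p) \<le> ?snd MQ p" if "h \<in> S" for h p
      using leQ[OF that] by (auto simp: Qt_def split: prod.splits)
    show "(Qt h has_sum Q h) UNIV" if "h \<in> S" for h
      unfolding Qt_def by (rule has_sum_shift_snd[OF Q[OF that]])
  qed
  have fS: "(series_term A h has_sum f (z + h)) UNIV" if "h \<in> S" for h
    using fsum[of "fst h" "snd h"] that r(2) by (cases z, cases h) (auto simp: S_iff)
  have "\<exists>g. \<forall>h\<in>S. (\<lambda>n. series_term A h (prod_decode n)) sums g h \<and>
      (g has_derivative (\<lambda>k. P h * fst k + Q h * snd k)) (at h within S)"
  proof (rule has_derivative_series[OF S(2)])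
    show "((\<lambda>h. series_term A h (prod_decode n)) has_derivative
        (\<lambda>k. Pt h (prod_decode n) * fst k + Qt h (prod_decode n) * snd k)) (at h within S)" for n h
    proof -
      obtain i j where n: "prod_decode n = (i, j)" by force
      show ?thesis
        unfolding n series_term_def Pt_def Qt_def
        by (cases i; cases j)
           (auto intro!: derivative_eq_intros simp: algebra_simps fun_eq_iff simp del: power_Suc)
    qed
    show "\<forall>\<^sub>F N in sequentially. \<forall>h\<in>S. \<forall>k.
      norm ((\<Sum>n<N. Pt h (prod_decode n) * fst k + Qt h (prod_decode n) * snd k)
            - (P h * fst k + Q h * snd k)) \<le> e * norm k" if "e > 0" for e
    proof -
      have "e / 2 > 0" using that by simp
      from uniform_limitD[OF limP this] uniform_limitD[OF limQ this] show ?thesis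
      proof eventually_elim
        case (elim N)
        show ?case
        proof safe
          fix h :: "'a \<times> 'a" and a b :: 'a assume h: "h \<in> S"
          let ?p = "(\<Sum>n<N. Pt h (prod_decode n)) - P h" and ?q = "(\<Sum>n<N. Qt h (prod_decode n)) - Q h"
          have "(\<Sum>n<N. Pt h (prod_decode n) * a + Qt h (prod_decode n) * b) - (P h * a + Q h * b)
             = ?p * a + ?q * b"
            by (simp add: sum.distrib left_diff_distrib flip: sum_distrib_right)
          also have "norm \<dots> \<le> norm ?p * norm a + norm ?q * norm b"
            by (metis norm_mult norm_triangle_ineq)
          also have "\<dots> \<le> e / 2 * norm (a, b) + e / 2 * norm (a, b)"
            using elim h \<open>e > 0\<close> norm_fst_le[of a b] norm_snd_le[of b a]
            by (intro add_mono mult_mono) (auto simp: dist_norm less_imp_le)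
          finally show "norm ((\<Sum>n<N. Pt h (prod_decode n) * fst (a, b) + Qt h (prod_decode n) * snd (a, b))
            - (P h * fst (a, b) + Q h * snd (a, b))) \<le> e * norm (a, b)" by simp
        qed
      qed
    qed
    show "0 \<in> S" by (rule S(3))
    show "(\<lambda>n. series_term A 0 (prod_decode n)) sums f (z + 0)"
      by (rule has_sum_prod_decode_sums[OF fS[OF S(3)]])
  qed
  then obtain g where g: "\<And>h. h \<in> S \<Longrightarrow> (\<lambda>n. series_term A h (prod_decode n)) sums g h"
    "\<And>h. h \<in> S \<Longrightarrow> (g has_derivative (\<lambda>k. P h * fst k + Q h * snd k)) (at h within S)"
    by blast
  have gf: "g h = f (z + h)" if "h \<in> S" for h
    using g(1)[OF that] has_sum_prod_decode_sums[OF fS[OF that]] sums_unique2 by blast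
  have "\<forall>\<^sub>F w in nhds z. w - z \<in> S"
    unfolding eventually_nhds_prod_norm using r(1) by (intro exI[of _ r]) (auto simp: S_iff)
  then have "\<forall>\<^sub>F w in nhds z.
      (f has_derivative (\<lambda>h. P (w - z) * fst h + Q (w - z) * snd h)) (at w)"
  proof eventually_elim
    case (elim w)
    have 1: "(g has_derivative (\<lambda>k. P (w - z) * fst k + Q (w - z) * snd k)) (at (w - z))"
      using g(2)[OF elim] at_within_open[OF elim S(1)] by simp
    have 2: "((\<lambda>v. g (v - z)) has_derivative (\<lambda>k. P (w - z) * fst k + Q (w - z) * snd k)) (at w)"
    proof (rule has_derivative_compose[of "\<lambda>v. v - z" "\<lambda>k. k" w UNIV g])
      show "((\<lambda>v. v - z) has_derivative (\<lambda>k. k)) (at w)"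
        by (auto intro!: derivative_eq_intros)
    qed (rule 1)
    have "open ((\<lambda>h. z + h) ` S)" using S(1) by (rule open_translation)
    moreover have "w \<in> (\<lambda>h. z + h) ` S" using elim by (intro image_eqI[of _ _ "w - z"]) auto
    ultimately show ?case
      by (rule has_derivative_transform_within_open[OF 2]) (auto simp: gf)
  qed
  moreover have "has_series (\<lambda>w. P (w - z)) z (series_ds A)"
    unfolding P_def by (rule convergent2_has_series[OF conv(1)])
  moreover have "has_series (\<lambda>w. Q (w - z)) z (series_dt A)"
    unfolding Q_def by (rule convergent2_has_series[OF conv(2)])
  ultimately show ?thesis by (intro that)
qed

lemma has_series_zero_derivs:
  assumes "has_series (\<lambda>_. 0) z A"
  shows "has_series (\<lambda>_. 0) z (series_ds A)" "has_series (\<lambda>_. 0) z (series_dt A)"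
proof -
  obtain P Q where PQ: "has_series P z (series_ds A)" "has_series Q z (series_dt A)"
    "\<forall>\<^sub>F w in nhds z. ((\<lambda>_. 0) has_derivative (\<lambda>h. P w * fst h + Q w * snd h)) (at w)"
    using has_series_has_derivative[OF assms] .
  from PQ(3) have ev: "\<forall>\<^sub>F w in nhds z. P w = 0 \<and> Q w = 0"
  proof eventually_elim
    case (elim w)
    have "(\<lambda>h. P w * fst h + Q w * snd h) = (\<lambda>_. 0)"
      by (rule has_derivative_unique[OF elim]) simp
    from fun_cong[OF this, of "(1, 0)"] fun_cong[OF this, of "(0, 1)"] show ?case by simp
  qed
  from ev have "\<forall>\<^sub>F w in nhds z. P w = 0" "\<forall>\<^sub>F w in nhds z. Q w = 0"
    by (eventually_elim, simp)+
  with PQ(1,2) show "has_series (\<lambda>_. 0) z (series_ds A)" "has_series (\<lambda>_. 0) z (series_dt A)"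
    using has_series_cong[of P "\<lambda>_. 0" z] has_series_cong[of Q "\<lambda>_. 0" z] by auto
qed

text \<open>Every coefficient is, up to a non-zero integer factor, the value at the centre of an iterated
  partial derivative, and all derivatives of the zero function are zero.\<close>

lemma has_series_zero:
  assumes "has_series (\<lambda>_. 0) z A"
  shows "A = 0"
proof (rule coeff2_eqI)
  have *: "has_series (\<lambda>_. 0) z B \<Longrightarrow> coeff2 B 0 j = 0" for B j
  proof (induction j arbitrary: B)
    case 0 then show ?case using has_series_at_center by fastforce
  next
    case (Suc j)
    from Suc.IH[OF has_series_zero_derivs(2)[OF Suc.prems]] show ?case
      by (simp del: of_nat_Suc)
  qed
  fix i j
  from assms show "coeff2 A i j = coeff2 0 i j"
  proof (induction i arbitrary: A)
    case 0 then show ?case using * by simp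
  next
    case (Suc i)
    from Suc.IH[OF has_series_zero_derivs(1)[OF Suc.prems]] show ?case
      by (simp del: of_nat_Suc)
  qed
qed

section \<open>Complexification of real analytic germs\<close>

definition complexify :: "real fps fps \<Rightarrow> complex fps fps" where
  "complexify A = Abs_fps (\<lambda>i. Abs_fps (\<lambda>j. complex_of_real (coeff2 A i j)))"

lemma coeff2_complexify [simp]: "coeff2 (complexify A) i j = complex_of_real (coeff2 A i j)"
  by (simp add: complexify_def)

lemma eventually_complex_point:
  assumes "eventually P (nhds (complex_point q))"
  shows "\<forall>\<^sub>F z in nhds q. P (complex_point z)"
proof -
  have "filterlim complex_point (nhds (complex_point q)) (nhds q)"
    unfolding complex_point_def by (intro tendsto_intros filterlim_ident)
  with assms show ?thesis by (auto simp: filterlim_iff)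
qed

lemma has_series_complexify:
  assumes f: "has_series f q A"
  obtains h where "has_series h (complex_point q) (complexify A)"
    "\<forall>\<^sub>F z in nhds q. h (complex_point z) = complex_of_real (f z)"
proof -
  obtain C K where CK: "C > 0" "K > 0" "\<And>i j. norm (coeff2 A i j) \<le> C * K ^ (i + j)"
    using has_series_convergent2[OF f] unfolding convergent2_def by blast
  have "convergent2 (complexify A)"
    using CK by (intro convergent2I[of _ C K]) auto
  then have h: "has_series (\<lambda>w. infsum (series_term (complexify A) (w - complex_point q)) UNIV)
      (complex_point q) (complexify A)" (is "has_series ?h _ _")
    by (rule convergent2_has_series)
  have "\<forall>\<^sub>F z in nhds q. ?h (complex_point z) = complex_of_real (f z)"
    using f[unfolded has_series_def]
  proof eventually_elim
    case (elim z)
    have "series_term (complexify A) (complex_point z - complex_point q)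
        = (\<lambda>p. complex_of_real (series_term A (z - q) p))"
      by (auto simp: series_term_def complex_point_def)
    with has_sum_of_real[OF elim, where 'a = complex] show ?case by (auto intro!: infsumI)
  qed
  with h show ?thesis by (rule that)
qed

text \<open>The reals are a set of uniqueness: on real points, the real and imaginary parts of the
  coefficients are coefficients of real power series for the zero function.\<close>

lemma has_series_zero_on_reals:
  assumes h: "has_series h (complex_point q) H"
    and z: "\<forall>\<^sub>F z in nhds q. h (complex_point z) = 0"
  shows "H = 0"
proof -
  have part: "(\<lambda>i j. g (coeff2 H i j)) = (\<lambda>i j. 0)"
    if g: "bounded_linear g" "\<And>c x. g (c * complex_of_real x) = g c * x" for g :: "complex \<Rightarrow> real"
  proof -
    define R :: "real fps fps" where "R = Abs_fps (\<lambda>i. Abs_fps (\<lambda>j. g (coeff2 H i j)))"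
    have "has_series (\<lambda>_. 0) q R"
      unfolding has_series_def
      using z eventually_complex_point[OF h[unfolded has_series_def]]
    proof eventually_elim
      case (elim z)
      have "(\<lambda>p. g (series_term H (complex_point z - complex_point q) p)) = series_term R (z - q)"
        by (auto simp: series_term_def R_def complex_point_def mult.assoc g(2)
              simp flip: of_real_diff of_real_power of_real_mult)
      with has_sum_bounded_linear[OF g(1) elim(2)] elim(1) bounded_linear.linear[OF g(1)]
      show ?case by (simp add: linear_0)
    qed
    then have "R = 0" by (rule has_series_zero)
    then have "coeff2 R i j = 0" for i j by simp
    then show ?thesis by (simp add: R_def)
  qed
  show ?thesis
  proof (intro coeff2_eqI complex_eqI)
    fix i j
    show "Re (coeff2 H i j) = Re (coeff2 0 i j)"
      using fun_cong[OF fun_cong[OF part[OF bounded_linear_Re]], of i j] by simp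
    show "Im (coeff2 H i j) = Im (coeff2 0 i j)"
      using fun_cong[OF fun_cong[OF part[OF bounded_linear_Im]], of i j] by simp
  qed
qed

lemma germ_eq_iff: "germ z f = germ z g \<longleftrightarrow> (\<forall>\<^sub>F w in nhds z. f w = g w)"
proof
  assume "germ z f = germ z g"
  moreover have "f \<in> germ z f" by (simp add: germ_def)
  ultimately have "f \<in> germ z g" by simp
  then show "\<forall>\<^sub>F w in nhds z. f w = g w" by (simp add: germ_def)
next
  assume *: "\<forall>\<^sub>F w in nhds z. f w = g w"
  have "(\<forall>\<^sub>F w in nhds z. k w = f w) \<longleftrightarrow> (\<forall>\<^sub>F w in nhds z. k w = g w)" for k
    by (rule eventually_cong[OF *]) simp
  then show "germ z f = germ z g" by (simp add: germ_def)
qed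

text \<open>Existence comes from the same coefficients read as complex numbers, uniqueness from
  \<open>has_series_zero_on_reals\<close>.\<close>

lemma complexified_germ_has_series:
  assumes f: "has_series f q A"
  obtains h where "has_series h (complex_point q) (complexify A)"
    "complexified_germ f q = germ (complex_point q) h"
proof -
  obtain h where h: "has_series h (complex_point q) (complexify A)"
    and hf: "\<forall>\<^sub>F z in nhds q. h (complex_point z) = complex_of_real (f z)"
    using has_series_complexify[OF f] .
  have "complexified_germ f q = germ (complex_point q) h"
  proof (rule equalityI; rule subsetI)
    fix k assume "k \<in> complexified_germ f q"
    then obtain B where k: "has_series k (complex_point q) B"
      and kf: "\<forall>\<^sub>F z in nhds q. k (complex_point z) = complex_of_real (f z)"
      unfolding complexified_germ_def analytic2_at_iff_has_series by blast
    have "complexify A - B = 0"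
      by (rule has_series_zero_on_reals[OF has_series_diff[OF h k]])
         (use hf kf in eventually_elim, simp)
    with k h have "\<forall>\<^sub>F w in nhds (complex_point q). k w = h w"
      by (intro has_series_eq[of _ _ "complexify A"]) auto
    then show "k \<in> germ (complex_point q) h" by (simp add: germ_def)
  next
    fix k assume "k \<in> germ (complex_point q) h"
    then have kh: "\<forall>\<^sub>F w in nhds (complex_point q). k w = h w" by (simp add: germ_def)
    have "has_series k (complex_point q) (complexify A)"
      using has_series_cong[OF kh] h by simp
    moreover have "\<forall>\<^sub>F z in nhds q. k (complex_point z) = complex_of_real (f z)"
      using eventually_complex_point[OF kh] hf by eventually_elim simp
    ultimately show "k \<in> complexified_germ f q"
      unfolding complexified_germ_def analytic2_at_iff_has_series by blast
  qed
  with h show ?thesis by (rule that)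
qed

section \<open>Inversion and division of convergent series\<close>

text \<open>Apart from the leading term \<open>1\<close> the sum is \<open>O(x)\<close>, uniformly in \<open>i\<close> and \<open>j\<close>; the constant \<open>6\<close>
  comes from \<open>(1 + 2 x)\<^sup>2 \<le> 1 + 6 x\<close> for \<open>x \<le> 1 / 2\<close>.\<close>

lemma square_geometric_bound:
  fixes x :: real
  assumes "0 \<le> x" "x \<le> 1 / 2"
  shows "(\<Sum>k\<le>i. \<Sum>l\<le>j. x ^ (k + l)) \<le> 1 + 6 * x"
proof -
  have *: "(\<Sum>k\<le>n. x ^ k) \<le> 1 + 2 * x" for n
  proof -
    have "(\<Sum>k\<le>n. x ^ k) = (1 - x ^ Suc n) / (1 - x)"
      using assms by (simp add: sum_gp0)
    also have "\<dots> \<le> 1 / (1 - x)"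
      using assms by (intro divide_right_mono) auto
    also have "\<dots> \<le> 1 + 2 * x"
      using assms mult_nonneg_nonneg[of x "1 - 2 * x"] by (simp add: field_simps)
    finally show ?thesis .
  qed
  have "(\<Sum>k\<le>i. \<Sum>l\<le>j. x ^ (k + l)) = (\<Sum>k\<le>i. x ^ k) * (\<Sum>l\<le>j. x ^ l)"
    by (simp add: power_add sum_product)
  also have "\<dots> \<le> (1 + 2 * x) * (1 + 2 * x)"
    using assms by (intro mult_mono * sum_nonneg) auto
  also have "\<dots> \<le> 1 + 6 * x"
    using assms mult_nonneg_nonneg[of x "1 - 2 * x"] by (simp add: algebra_simps)
  finally show ?thesis .
qed

text \<open>The inverse exists formally. In the recursion for its coefficients, the coefficient at \<open>(i, j)\<close>
  is a combination of those at lower exponents, and a bound \<open>1 / a * L ^ (i + j)\<close> propagates as soon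
  as \<open>L\<close> is so large that the non-constant part of \<open>A\<close> is dominated by the constant one on the
  polydisc of radius \<open>1 / L\<close>.\<close>

lemma convergent2_inverse:
  fixes A :: "'a::real_normed_field fps fps"
  assumes A: "convergent2 A" and A0: "coeff2 A 0 0 \<noteq> 0"
  obtains B where "convergent2 B" "A * B = 1"
proof -
  define B where "B = fps_right_inverse A (inverse (fps_nth A 0))"
  have "fps_nth A 0 * inverse (fps_nth A 0) = 1"
    using A0 by (simp add: inverse_mult_eq_1')
  then have AB: "A * B = 1" unfolding B_def by (rule fps_right_inverse)
  define a where "a = norm (coeff2 A 0 0)"
  have a: "a > 0" using A0 by (simp add: a_def)
  obtain C K where CK: "C > 0" "K > 0" "\<And>i j. norm (coeff2 A i j) \<le> C * K ^ (i + j)"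
    using A unfolding convergent2_def by blast
  \<comment> \<open>With the ratio \<open>x = K / L\<close>, the sum of \<open>C * x ^ (k + l)\<close> over \<open>(k, l) \<noteq> (0, 0)\<close> is at most
    \<open>6 * x * C\<close>, which has to be at most \<open>a\<close>.\<close>
  define x where "x = min (1 / 2) (a / (6 * C))"
  have x: "0 < x" "x \<le> 1 / 2" "6 * x * C \<le> a"
    using a CK(1) by (auto simp: x_def min_def field_simps)
  define L where "L = K / x"
  have L: "L > 0" "K = x * L" using CK(2) x(1) by (auto simp: L_def)
  have "norm (coeff2 B i j) \<le> 1 / a * L ^ (i + j)" for i j
  proof (induction "i + j" arbitrary: i j rule: less_induct)
    case less
    let ?I = "{..i} \<times> {..j}"
    let ?F = "\<lambda>(k, l). coeff2 A k l * coeff2 B (i - k) (j - l)"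
    have "sum ?F ?I = coeff2 (A * B) i j" by (simp add: coeff2_mult sum.cartesian_product)
    also have "\<dots> = (if i = 0 \<and> j = 0 then 1 else 0)" by (auto simp: AB)
    finally have "sum ?F ?I = (if i = 0 \<and> j = 0 then 1 else 0)" .
    moreover have "sum ?F ?I = coeff2 A 0 0 * coeff2 B i j + sum ?F (?I - {(0, 0)})"
      by (subst sum.remove[of _ "(0, 0)"]) auto
    ultimately have eq: "coeff2 A 0 0 * coeff2 B i j
        = (if i = 0 \<and> j = 0 then 1 else 0) - sum ?F (?I - {(0, 0)})" by (simp add: algebra_simps)
    show ?case
    proof (cases "i = 0 \<and> j = 0")
      case True
      then have "coeff2 A 0 0 * coeff2 B i j = 1" using eq by auto
      then have "a * norm (coeff2 B i j) = 1" unfolding a_def by (metis norm_mult norm_one)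
      then show ?thesis using a True by (simp add: field_simps)
    next
      case False
      have "coeff2 A 0 0 * coeff2 B i j = - sum ?F (?I - {(0, 0)})"
        unfolding eq using False by (simp only: if_False diff_0)
      then have "norm (coeff2 A 0 0 * coeff2 B i j) = norm (sum ?F (?I - {(0, 0)}))"
        by (simp only: norm_minus_cancel)
      then have "a * norm (coeff2 B i j) = norm (sum ?F (?I - {(0, 0)}))"
        by (simp only: a_def norm_mult)
      also have "\<dots> \<le> (\<Sum>p\<in>?I - {(0, 0)}. norm (?F p))" by (rule norm_sum)
      also have "\<dots> \<le> (\<Sum>(k, l)\<in>?I - {(0, 0)}. C / a * L ^ (i + j) * x ^ (k + l))"
      proof (rule sum_mono)
        fix p assume p: "p \<in> ?I - {(0, 0)}"
        obtain k l where kl: "p = (k, l)" by force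
        have le: "k \<le> i" "l \<le> j" "(i - k) + (j - l) < i + j" using p kl by auto
        have "norm (?F p) = norm (coeff2 A k l) * norm (coeff2 B (i - k) (j - l))"
          by (simp add: kl norm_mult)
        also have "\<dots> \<le> C * K ^ (k + l) * (1 / a * L ^ ((i - k) + (j - l)))"
          using CK(1,2) by (intro mult_mono CK(3) less.hyps le) auto
        also have "\<dots> = C / a * (L ^ (k + l) * L ^ ((i - k) + (j - l))) * x ^ (k + l)"
          by (simp add: L(2) power_mult_distrib)
        also have "L ^ (k + l) * L ^ ((i - k) + (j - l)) = L ^ (i + j)"
          using le by (simp flip: power_add)
        finally show "norm (?F p) \<le> (case p of (k, l) \<Rightarrow> C / a * L ^ (i + j) * x ^ (k + l))"
          by (simp add: kl)
      qed
      also have "\<dots> = C / a * L ^ (i + j) * (\<Sum>(k, l)\<in>?I - {(0, 0)}. x ^ (k + l))"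
        by (simp add: sum_distrib_left case_prod_unfold)
      also have "(\<Sum>(k, l)\<in>?I - {(0, 0)}. x ^ (k + l)) = (\<Sum>k\<le>i. \<Sum>l\<le>j. x ^ (k + l)) - 1"
        by (subst sum_diff1) (auto simp: sum.cartesian_product)
      also have "C / a * L ^ (i + j) * \<dots> \<le> C / a * L ^ (i + j) * (6 * x)"
        using square_geometric_bound[of x j i] x CK(1) a L(1) by (intro mult_left_mono) auto
      also have "\<dots> = (6 * x * C) * (1 / a * L ^ (i + j))" by simp
      also have "\<dots> \<le> a * (1 / a * L ^ (i + j))"
        using x a L by (intro mult_right_mono) auto
      finally show ?thesis by (rule mult_left_le_imp_le[OF _ a])
    qed
  qed
  then have "convergent2 B" using a L by (intro convergent2I[of _ "1 / a" L]) auto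
  with AB show ?thesis by (intro that)
qed

lemma has_series_inverse:
  assumes f: "has_series f z A" and "f z \<noteq> 0"
  obtains g B where "has_series g z B" "\<forall>\<^sub>F w in nhds z. f w * g w = 1"
proof -
  have "coeff2 A 0 0 \<noteq> 0" using assms has_series_at_center by metis
  then obtain B where B: "convergent2 B" "A * B = 1"
    using convergent2_inverse has_series_convergent2[OF f] by blast
  define g where "g = (\<lambda>w. infsum (series_term B (w - z)) UNIV)"
  have g: "has_series g z B" unfolding g_def by (rule convergent2_has_series[OF B(1)])
  have "1 = series_const (1 :: 'a)" by (simp add: series_const_def)
  with has_series_mult[OF f g] B(2) have "has_series (\<lambda>w. f w * g w) z (series_const 1)" by simp
  from has_series_eq[OF this has_series_const] g show ?thesis by (intro that)
qed

text \<open>Division by the coordinates: the monomials containing the first variable are collected in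
  \<open>g\<close>, the powers of the second variable alone in \<open>k\<close>.\<close>

lemma has_series_split:
  assumes f: "has_series f z A" and f0: "f z = 0"
  obtains g k where "analytic2_at g z" "analytic2_at k z" "g z = coeff2 A 1 0" "k z = coeff2 A 0 1"
    "\<forall>\<^sub>F w in nhds z. f w = (fst w - fst z) * g w + (snd w - snd z) * k w"
proof -
  define G where "G = Abs_fps (\<lambda>i. Abs_fps (\<lambda>j. coeff2 A (Suc i) j))"
  define H where "H = Abs_fps (\<lambda>i. Abs_fps (\<lambda>j. if i = 0 then coeff2 A 0 (Suc j) else 0))"
  obtain C K where CK: "C > 0" "K > 0" "\<And>i j. norm (coeff2 A i j) \<le> C * K ^ (i + j)"
    using has_series_convergent2[OF f] unfolding convergent2_def by blast
  have "norm (coeff2 G i j) \<le> (C * K) * K ^ (i + j)" for i j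
    using CK(3)[of "Suc i" j] by (simp add: G_def mult_ac)
  then have G: "convergent2 G" using CK by (intro convergent2I[of _ "C * K" K]) auto
  have "norm (coeff2 H i j) \<le> (C * K) * K ^ (i + j)" for i j
    using CK(3)[of i "Suc j"] CK(1,2) by (auto simp: H_def mult_ac)
  then have H: "convergent2 H" using CK by (intro convergent2I[of _ "C * K" K]) auto
  have "coeff2 A 0 0 = 0" using f f0 has_series_at_center by metis
  then have A: "A = series_s * G + series_t * H"
    by (intro coeff2_eqI) (auto simp: G_def H_def)
  define g where "g = (\<lambda>w. infsum (series_term G (w - z)) UNIV)"
  define k where "k = (\<lambda>w. infsum (series_term H (w - z)) UNIV)"
  have g: "has_series g z G" unfolding g_def by (rule convergent2_has_series[OF G])
  have k: "has_series k z H" unfolding k_def by (rule convergent2_has_series[OF H])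
  have "has_series (\<lambda>w. (fst w - fst z) * g w + (snd w - snd z) * k w) z A"
    unfolding A by (intro has_series_add has_series_mult has_series_s has_series_t g k)
  from has_series_eq[OF f this] has_series_at_center[OF g] has_series_at_center[OF k] g k
  show ?thesis by (intro that[of g k]) (auto simp: analytic2_at_iff_has_series G_def H_def)
qed

section \<open>The ring of holomorphic germs and its maximal ideal\<close>

lemma analytic2_at_add:
  "analytic2_at f z \<Longrightarrow> analytic2_at g z \<Longrightarrow> analytic2_at (\<lambda>w. f w + g w) z"
  unfolding analytic2_at_iff_has_series using has_series_add by blast

lemma analytic2_at_mult:
  "analytic2_at f z \<Longrightarrow> analytic2_at g z \<Longrightarrow> analytic2_at (\<lambda>w. f w * g w) z"
  unfolding analytic2_at_iff_has_series using has_series_mult by blast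

lemma analytic2_at_uminus: "analytic2_at f z \<Longrightarrow> analytic2_at (\<lambda>w. - f w) z"
  unfolding analytic2_at_iff_has_series using has_series_uminus by blast

lemma analytic2_at_const: "analytic2_at (\<lambda>_. c) z"
  unfolding analytic2_at_iff_has_series using has_series_const by blast

lemma germ_self: "f \<in> germ z f"
  by (simp add: germ_def)

lemma germ_eqI: "\<forall>\<^sub>F w in nhds z. f w = g w \<Longrightarrow> germ z f = germ z g"
  by (simp add: germ_eq_iff)

lemma germ_value: "germ z f = germ z g \<Longrightarrow> f z = g z"
  unfolding germ_eq_iff by (auto dest: eventually_nhds_x_imp_x)

lemma carrier_O2: "X \<in> carrier (O2 z) \<longleftrightarrow> (\<exists>f. X = germ z f \<and> analytic2_at f z)"
  by (auto simp: O2_def)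

lemma carrier_O2_E:
  assumes "X \<in> carrier (O2 z)"
  obtains f where "X = germ z f" "analytic2_at f z"
  using assms unfolding carrier_O2 by blast

lemma germ_carrier: "analytic2_at f z \<Longrightarrow> germ z f \<in> carrier (O2 z)"
  unfolding carrier_O2 by blast

lemma O2_mult: "germ z f \<otimes>\<^bsub>O2 z\<^esub> germ z g = germ z (\<lambda>w. f w * g w)"
proof (rule equalityI; rule subsetI)
  fix h assume "h \<in> germ z f \<otimes>\<^bsub>O2 z\<^esub> germ z g"
  then obtain f' g' where "\<forall>\<^sub>F w in nhds z. f' w = f w" "\<forall>\<^sub>F w in nhds z. g' w = g w"
    "\<forall>\<^sub>F w in nhds z. h w = f' w * g' w" by (auto simp: O2_def germ_def)
  then have "\<forall>\<^sub>F w in nhds z. h w = f w * g w" by eventually_elim simp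
  then show "h \<in> germ z (\<lambda>w. f w * g w)" by (simp add: germ_def)
next
  fix h assume "h \<in> germ z (\<lambda>w. f w * g w)"
  then have "\<forall>\<^sub>F w in nhds z. h w = f w * g w" by (simp add: germ_def)
  then show "h \<in> germ z f \<otimes>\<^bsub>O2 z\<^esub> germ z g"
    using germ_self[of f z] germ_self[of g z] by (auto simp: O2_def)
qed

lemma O2_add: "germ z f \<oplus>\<^bsub>O2 z\<^esub> germ z g = germ z (\<lambda>w. f w + g w)"
proof (rule equalityI; rule subsetI)
  fix h assume "h \<in> germ z f \<oplus>\<^bsub>O2 z\<^esub> germ z g"
  then obtain f' g' where "\<forall>\<^sub>F w in nhds z. f' w = f w" "\<forall>\<^sub>F w in nhds z. g' w = g w"
    "\<forall>\<^sub>F w in nhds z. h w = f' w + g' w" by (auto simp: O2_def germ_def)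
  then have "\<forall>\<^sub>F w in nhds z. h w = f w + g w" by eventually_elim simp
  then show "h \<in> germ z (\<lambda>w. f w + g w)" by (simp add: germ_def)
next
  fix h assume "h \<in> germ z (\<lambda>w. f w + g w)"
  then have "\<forall>\<^sub>F w in nhds z. h w = f w + g w" by (simp add: germ_def)
  then show "h \<in> germ z f \<oplus>\<^bsub>O2 z\<^esub> germ z g"
    using germ_self[of f z] germ_self[of g z] by (auto simp: O2_def)
qed

lemma O2_one: "\<one>\<^bsub>O2 z\<^esub> = germ z (\<lambda>_. 1)"
  and O2_zero: "\<zero>\<^bsub>O2 z\<^esub> = germ z (\<lambda>_. 0)"
  by (simp_all add: O2_def)

lemma cring_O2: "cring (O2 z)"
proof (rule cringI)
  show "abelian_group (O2 z)"
  proof (rule abelian_groupI)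
    fix X assume "X \<in> carrier (O2 z)"
    then obtain f where f: "X = germ z f" "analytic2_at f z" unfolding carrier_O2 by blast
    show "\<exists>Y\<in>carrier (O2 z). Y \<oplus>\<^bsub>O2 z\<^esub> X = \<zero>\<^bsub>O2 z\<^esub>"
      by (intro bexI[of _ "germ z (\<lambda>w. - f w)"] germ_carrier analytic2_at_uminus f(2))
         (simp add: f(1) O2_add O2_zero)
  qed (auto simp: O2_add O2_zero add_ac elim!: carrier_O2_E
        intro!: germ_carrier analytic2_at_add analytic2_at_const)
  show "Group.comm_monoid (O2 z)"
    by (rule comm_monoidI)
       (auto simp: O2_mult O2_one mult_ac elim!: carrier_O2_E
         intro!: germ_carrier analytic2_at_mult analytic2_at_const)
qed (auto simp: O2_add O2_mult distrib_right elim!: carrier_O2_E)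

definition maximal_germs :: "complex \<times> complex \<Rightarrow> cfun2 set set" where
  "maximal_germs z = {germ z f | f. analytic2_at f z \<and> f z = 0}"

lemma maximal_germsI: "analytic2_at f z \<Longrightarrow> f z = 0 \<Longrightarrow> germ z f \<in> maximal_germs z"
  unfolding maximal_germs_def by blast

lemma germ_in_maximal: "germ z f \<in> maximal_germs z \<Longrightarrow> f z = 0"
  unfolding maximal_germs_def by (auto dest: germ_value)

lemma O2_a_inv:
  assumes "analytic2_at f z"
  shows "\<ominus>\<^bsub>O2 z\<^esub> germ z f = germ z (\<lambda>w. - f w)"
proof -
  interpret cring "O2 z" by (rule cring_O2)
  have "germ z (\<lambda>w. - f w) \<oplus>\<^bsub>O2 z\<^esub> germ z f = \<zero>\<^bsub>O2 z\<^esub>"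
    by (simp add: O2_add O2_zero)
  then show ?thesis
    using assms by (intro minus_equality germ_carrier analytic2_at_uminus)
qed

lemma ideal_maximal_germs: "ideal (maximal_germs z) (O2 z)"
proof -
  interpret cring "O2 z" by (rule cring_O2)
  show ?thesis
  proof (rule idealI[OF ring_axioms])
    show "subgroup (maximal_germs z) (add_monoid (O2 z))"
    proof (rule add.subgroupI)
      show "maximal_germs z \<subseteq> carrier (O2 z)" by (auto simp: maximal_germs_def germ_carrier)
      show "maximal_germs z \<noteq> {}"
        using analytic2_at_const[of 0 z] unfolding maximal_germs_def by blast
    next
      fix X assume "X \<in> maximal_germs z"
      then obtain f where "X = germ z f" "analytic2_at f z" "f z = 0"
        unfolding maximal_germs_def by blast
      then show "\<ominus>\<^bsub>O2 z\<^esub> X \<in> maximal_germs z"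
        by (auto simp: O2_a_inv intro!: maximal_germsI analytic2_at_uminus)
    next
      fix X Y assume "X \<in> maximal_germs z" "Y \<in> maximal_germs z"
      then obtain f g where "X = germ z f" "analytic2_at f z" "f z = 0"
          "Y = germ z g" "analytic2_at g z" "g z = 0"
        unfolding maximal_germs_def by blast
      then show "X \<oplus>\<^bsub>O2 z\<^esub> Y \<in> maximal_germs z"
        by (auto simp: O2_add intro!: maximal_germsI analytic2_at_add)
    qed
  next
    fix X Y assume "X \<in> maximal_germs z" "Y \<in> carrier (O2 z)"
    then obtain f g where fg: "X = germ z f" "analytic2_at f z" "f z = 0"
        "Y = germ z g" "analytic2_at g z"
      unfolding maximal_germs_def carrier_O2 by blast
    then show "Y \<otimes>\<^bsub>O2 z\<^esub> X \<in> maximal_germs z"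
      by (auto simp: O2_mult intro!: maximal_germsI analytic2_at_mult)
    show "X \<otimes>\<^bsub>O2 z\<^esub> Y \<in> maximal_germs z"
      using fg by (auto simp: O2_mult intro!: maximal_germsI analytic2_at_mult)
  qed
qed

text \<open>A germ \<open>f\<close> with \<open>f z \<noteq> 0\<close> becomes, after scaling, \<open>1\<close> minus a germ vanishing at \<open>z\<close>, so an ideal
  containing \<open>f\<close> and all germs vanishing at \<open>z\<close> contains \<open>1\<close>.\<close>

lemma maximalideal_maximal_germs: "maximalideal (maximal_germs z) (O2 z)"
proof (rule maximalidealI[OF ideal_maximal_germs])
  interpret cring "O2 z" by (rule cring_O2)
  have "germ z (\<lambda>_. 1) \<notin> maximal_germs z" using germ_in_maximal by fastforce
  moreover have "germ z (\<lambda>_. 1) \<in> carrier (O2 z)" by (intro germ_carrier analytic2_at_const)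
  ultimately show "carrier (O2 z) \<noteq> maximal_germs z" by blast
  fix J assume J: "ideal J (O2 z)" "maximal_germs z \<subseteq> J" "J \<subseteq> carrier (O2 z)"
  interpret J: ideal J "O2 z" by (rule J(1))
  show "J = maximal_germs z \<or> J = carrier (O2 z)"
  proof (rule disjCI)
    assume "J \<noteq> carrier (O2 z)"
    show "J = maximal_germs z"
    proof (rule equalityI[OF _ J(2)]; rule subsetI; rule ccontr)
      fix X assume X: "X \<in> J" "X \<notin> maximal_germs z"
      then obtain f where f: "X = germ z f" "analytic2_at f z" using J(3) carrier_O2 by blast
      with X have f0: "f z \<noteq> 0" unfolding maximal_germs_def by blast
      let ?c = "\<lambda>_. inverse (f z)"
      have "germ z (\<lambda>w. ?c w * f w) \<in> J"
        using J.I_l_closed[OF X(1) germ_carrier[OF analytic2_at_const[of "inverse (f z)"]]]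
        by (simp add: f(1) O2_mult)
      moreover have "germ z (\<lambda>w. 1 + - (?c w * f w)) \<in> J"
        using f f0
        by (intro subsetD[OF J(2)] maximal_germsI analytic2_at_add analytic2_at_const
              analytic2_at_uminus analytic2_at_mult) auto
      ultimately have "germ z (\<lambda>w. ?c w * f w) \<oplus>\<^bsub>O2 z\<^esub> germ z (\<lambda>w. 1 + - (?c w * f w)) \<in> J"
        by (rule J.a_closed)
      then have "\<one>\<^bsub>O2 z\<^esub> \<in> J" by (simp add: O2_add O2_one)
      then have "J = carrier (O2 z)" by (rule J.one_imp_carrier)
      with \<open>J \<noteq> carrier (O2 z)\<close> show False by blast
    qed
  qed
qed

text \<open>A holomorphic form of the statement that functions with independent differentials are local
  coordinates. No change of coordinates is needed: if \<open>b = s b1 + t b2\<close>, \<open>c = s c1 + t c2\<close> and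
  \<open>f = s f1 + t f2\<close>, then \<open>D = b1 c2 - b2 c1\<close> is a unit, and Cramer's rule gives
  \<open>D f = (f1 c2 - f2 c1) b + (f2 b1 - f1 b2) c\<close>.\<close>

lemma genideal_eq_maximal_germs:
  assumes b: "has_series b z B" and c: "has_series c z C"
    and b0: "b z = 0" and c0: "c z = 0"
    and jac: "coeff2 B 1 0 * coeff2 C 0 1 - coeff2 B 0 1 * coeff2 C 1 0 \<noteq> 0"
  shows "genideal (O2 z) {germ z b, germ z c} = maximal_germs z"
proof (rule equalityI)
  interpret cring "O2 z" by (rule cring_O2)
  have ab: "analytic2_at b z" and ac: "analytic2_at c z"
    using b c analytic2_at_iff_has_series by blast+
  show "genideal (O2 z) {germ z b, germ z c} \<subseteq> maximal_germs z"
    by (rule genideal_minimal[OF ideal_maximal_germs])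
       (use ab ac b0 c0 in \<open>auto simp: maximal_germs_def\<close>)
  define I where "I = genideal (O2 z) {germ z b, germ z c}"
  have carr: "{germ z b, germ z c} \<subseteq> carrier (O2 z)" using ab ac germ_carrier by blast
  interpret I: ideal I "O2 z" unfolding I_def by (rule genideal_ideal[OF carr])
  have bI: "germ z b \<in> I" and cI: "germ z c \<in> I"
    unfolding I_def using genideal_self[OF carr] by auto
  obtain b1 b2 where b12: "analytic2_at b1 z" "analytic2_at b2 z" "b1 z = coeff2 B 1 0" "b2 z = coeff2 B 0 1"
    "\<forall>\<^sub>F w in nhds z. b w = (fst w - fst z) * b1 w + (snd w - snd z) * b2 w"
    using has_series_split[OF b b0] .
  obtain c1 c2 where c12: "analytic2_at c1 z" "analytic2_at c2 z" "c1 z = coeff2 C 1 0" "c2 z = coeff2 C 0 1"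
    "\<forall>\<^sub>F w in nhds z. c w = (fst w - fst z) * c1 w + (snd w - snd z) * c2 w"
    using has_series_split[OF c c0] .
  define D where "D = (\<lambda>w. b1 w * c2 w + - (b2 w * c1 w))"
  have "analytic2_at D z" unfolding D_def
    by (intro analytic2_at_add analytic2_at_mult analytic2_at_uminus b12 c12)
  then obtain DS where "has_series D z DS" unfolding analytic2_at_iff_has_series by blast
  moreover have "D z \<noteq> 0" using jac by (simp add: D_def b12 c12)
  ultimately obtain E ES where "has_series E z ES" and DE: "\<forall>\<^sub>F w in nhds z. D w * E w = 1"
    by (rule has_series_inverse)
  then have E: "analytic2_at E z" unfolding analytic2_at_iff_has_series by blast
  have comb: "germ z (\<lambda>w. f w * b w + g w * c w) \<in> I"
    if "analytic2_at f z" "analytic2_at g z" for f g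
    using I.a_closed[OF I.I_l_closed[OF bI germ_carrier[OF that(1)]]
        I.I_l_closed[OF cI germ_carrier[OF that(2)]]]
    by (simp add: O2_mult O2_add)
  show "maximal_germs z \<subseteq> genideal (O2 z) {germ z b, germ z c}"
  proof (rule subsetI)
    fix X assume "X \<in> maximal_germs z"
    then obtain f where X: "X = germ z f" and f: "analytic2_at f z" "f z = 0"
      unfolding maximal_germs_def by blast
    from f(1) obtain F where "has_series f z F" unfolding analytic2_at_iff_has_series by blast
    from has_series_split[OF this f(2)] obtain f1 f2 where f12:
      "analytic2_at f1 z" "analytic2_at f2 z"
      "\<forall>\<^sub>F w in nhds z. f w = (fst w - fst z) * f1 w + (snd w - snd z) * f2 w" .
    let ?p = "\<lambda>w. E w * (f1 w * c2 w + - (f2 w * c1 w))"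
    let ?q = "\<lambda>w. E w * (f2 w * b1 w + - (f1 w * b2 w))"
    have "\<forall>\<^sub>F w in nhds z. f w = ?p w * b w + ?q w * c w"
      using f12(3) b12(5) c12(5) DE
    proof eventually_elim
      case (elim w)
      define s where "s = fst w - fst z"
      define t where "t = snd w - snd z"
      have "?p w * b w + ?q w * c w = D w * E w * (s * f1 w + t * f2 w)"
        unfolding elim(2,3) D_def s_def[symmetric] t_def[symmetric] by (simp add: algebra_simps)
      then show ?case using elim(1,4) by (simp add: s_def t_def)
    qed
    then have "X = germ z (\<lambda>w. ?p w * b w + ?q w * c w)" unfolding X by (rule germ_eqI)
    also have "\<dots> \<in> I"
      by (intro comb analytic2_at_add analytic2_at_mult analytic2_at_uminus E b12 c12 f12)
    finally show "X \<in> genideal (O2 z) {germ z b, germ z c}" by (simp add: I_def)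
  qed
qed

text \<open>Every germ \<open>f\<close> is congruent to the constant \<open>f z\<close>.\<close>

lemma residue_classes_are_constants:
  "carrier (O2 z Quot maximal_germs z)
     = range (\<lambda>k. maximal_germs z +>\<^bsub>O2 z\<^esub> germ z (\<lambda>_. k))"
proof -
  interpret cring "O2 z" by (rule cring_O2)
  interpret ideal "maximal_germs z" "O2 z" by (rule ideal_maximal_germs)
  have coset: "maximal_germs z +>\<^bsub>O2 z\<^esub> germ z f = maximal_germs z +>\<^bsub>O2 z\<^esub> germ z (\<lambda>_. f z)"
    if f: "analytic2_at f z" for f
  proof -
    have m: "germ z (\<lambda>w. f w + - f z) \<in> maximal_germs z"
      by (intro maximal_germsI analytic2_at_add analytic2_at_const f) simp
    have "germ z f = germ z (\<lambda>w. f w + - f z) \<oplus>\<^bsub>O2 z\<^esub> germ z (\<lambda>_. f z)"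
      by (simp add: O2_add)
    also have "maximal_germs z +>\<^bsub>O2 z\<^esub> \<dots> = maximal_germs z +>\<^bsub>O2 z\<^esub> germ z (\<lambda>_. f z)"
      by (intro a_repr_independence'[symmetric] a_rcosI m a_subset germ_carrier analytic2_at_const)
    finally show ?thesis .
  qed
  have carr: "carrier (O2 z Quot maximal_germs z)
      = {maximal_germs z +>\<^bsub>O2 z\<^esub> X | X. X \<in> carrier (O2 z)}"
    by (auto simp: FactRing_def A_RCOSETS_defs a_r_coset_def)
  show ?thesis
  proof (rule equalityI; rule subsetI)
    fix Y assume "Y \<in> carrier (O2 z Quot maximal_germs z)"
    then obtain f where "Y = maximal_germs z +>\<^bsub>O2 z\<^esub> germ z f" "analytic2_at f z"
      unfolding carr by (auto elim: carrier_O2_E)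
    then show "Y \<in> range (\<lambda>k. maximal_germs z +>\<^bsub>O2 z\<^esub> germ z (\<lambda>_. k))"
      using coset by auto
  next
    fix Y assume "Y \<in> range (\<lambda>k. maximal_germs z +>\<^bsub>O2 z\<^esub> germ z (\<lambda>_. k))"
    then show "Y \<in> carrier (O2 z Quot maximal_germs z)"
      unfolding carr by (auto intro!: germ_carrier analytic2_at_const)
  qed
qed

text \<open>The dimension over the constants: by \<open>residue_classes_are_constants\<close> these are the whole residue
  field, which has dimension one over itself.\<close>

lemma dim_residue_field:
  fixes z
  defines "R \<equiv> O2 z Quot maximal_germs z"
  shows "ring.finite_dimension R (carrier R) (carrier R)" "ring.dim R (carrier R) (carrier R) = 1"
proof -
  interpret field R
    unfolding R_def by (rule maximalideal.quotient_is_field[OF maximalideal_maximal_germs cring_O2])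
  have K: "subfield (carrier R) R" by (rule carrier_is_subfield)
  have d: "dimension 1 (carrier R) (carrier R)" by (rule dimension_one[OF K])
  show "finite_dimension (carrier R) (carrier R)" by (rule finite_dimensionI[OF d])
  show "dim (carrier R) (carrier R) = 1" using dimI[OF K d] by (simp add: over_def)
qed

lemma m_u_eq_1:
  assumes b: "has_series (coeff_b x) q B" and c: "has_series (coeff_c x) q C"
    and b0: "coeff_b x q = 0" and c0: "coeff_c x q = 0"
    and jac: "coeff2 B 1 0 * coeff2 C 0 1 - coeff2 B 0 1 * coeff2 C 1 0 \<noteq> 0"
  shows "m_u x q = 1"
proof -
  define z where "z = complex_point q"
  obtain bc where bc: "has_series bc z (complexify B)" "complexified_germ (coeff_b x) q = germ z bc"
    using complexified_germ_has_series[OF b] unfolding z_def .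
  obtain cc where cc: "has_series cc z (complexify C)" "complexified_germ (coeff_c x) q = germ z cc"
    using complexified_germ_has_series[OF c] unfolding z_def .
  have I: "ideal_bc x q = maximal_germs z"
    unfolding ideal_bc_def bc(2) cc(2) z_def[symmetric]
  proof (rule genideal_eq_maximal_germs[OF bc(1) cc(1)])
    show "bc z = 0" "cc z = 0"
      using has_series_at_center[OF bc(1)] has_series_at_center[OF cc(1)]
        has_series_at_center[OF b] has_series_at_center[OF c] b0 c0 by simp_all
    show "coeff2 (complexify B) 1 0 * coeff2 (complexify C) 0 1
        - coeff2 (complexify B) 0 1 * coeff2 (complexify C) 1 0 \<noteq> 0"
      using jac by (simp flip: of_real_mult of_real_diff)
  qed
  have loc: "local_algebra x q = O2 z Quot maximal_germs z"
    by (simp add: local_algebra_def I z_def)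
  have "scalars x q = carrier (O2 z Quot maximal_germs z)"
    by (simp add: scalars_def I residue_classes_are_constants flip: z_def)
  with dim_residue_field[of z] show ?thesis
    unfolding m_u_def loc by (simp add: one_enat_def)
qed

section \<open>The second order behaviour of a cross-cap\<close>

lemma has_derivative_frechet: "f differentiable net \<Longrightarrow> (f has_derivative frechet_derivative f net) net"
  by (simp add: frechet_derivative_works)

lemma diffeo_germ_differentiable:
  assumes "diffeo_germ f a b"
  shows "\<forall>\<^sub>F p in nhds a. f differentiable (at p)"
    and "(\<lambda>p. frechet_derivative f (at p) w) differentiable (at a)"
proof -
  from assms obtain U where U: "open U" "a \<in> U" "smooth_on f U"
    unfolding diffeo_germ_def by blast
  then have C2: "Ck_on (Suc (Suc 0)) f U" unfolding smooth_on_def by blast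
  then have "\<forall>p\<in>U. f differentiable (at p)" by simp
  then show "\<forall>\<^sub>F p in nhds a. f differentiable (at p)"
    using eventually_nhds_in_open[OF U(1,2)] by (auto elim: eventually_mono)
  from C2 U(2) show "(\<lambda>p. frechet_derivative f (at p) w) differentiable (at a)" by simp
qed

lemma diffeo_germ_derivative_bij:
  assumes f: "diffeo_germ f a b"
  shows "bij (frechet_derivative f (at a))"
proof -
  from f obtain U V g where fa: "f a = b" and U: "open U" "a \<in> U" and V: "open V" "b \<in> V"
    and hom: "homeomorphism U V f g" and sm: "smooth_on f U" "smooth_on g V"
    unfolding diffeo_germ_def by blast
  have fg: "\<And>p. p \<in> U \<Longrightarrow> g (f p) = p" "\<And>r. r \<in> V \<Longrightarrow> f (g r) = r" and gb: "g b = a"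
    using hom U V fa unfolding homeomorphism_def by auto
  have "Ck_on (Suc 0) f U" "Ck_on (Suc 0) g V" using sm unfolding smooth_on_def by blast+
  then have "f differentiable (at a)" "g differentiable (at b)" using U V by auto
  then have df: "(f has_derivative frechet_derivative f (at a)) (at a)"
    and dg: "(g has_derivative frechet_derivative g (at b)) (at b)"
    by (auto intro: has_derivative_frechet)
  have "((\<lambda>p. g (f p)) has_derivative (\<lambda>h. frechet_derivative g (at b) (frechet_derivative f (at a) h))) (at a)"
    by (rule has_derivative_compose[OF df]) (simp add: fa dg)
  moreover have "((\<lambda>p. g (f p)) has_derivative (\<lambda>h. h)) (at a)"
    by (rule has_derivative_transform_within_open[OF has_derivative_ident U]) (simp add: fg)
  ultimately have 1: "frechet_derivative g (at b) (frechet_derivative f (at a) h) = h" for h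
    using has_derivative_unique by metis
  have "((\<lambda>p. f (g p)) has_derivative (\<lambda>h. frechet_derivative f (at a) (frechet_derivative g (at b) h))) (at b)"
    by (rule has_derivative_compose[OF dg]) (simp add: gb df)
  moreover have "((\<lambda>p. f (g p)) has_derivative (\<lambda>h. h)) (at b)"
    by (rule has_derivative_transform_within_open[OF has_derivative_ident V]) (simp add: fg)
  ultimately have 2: "frechet_derivative f (at a) (frechet_derivative g (at b) h) = h" for h
    using has_derivative_unique by metis
  show ?thesis by (rule o_bij[of "frechet_derivative g (at b)"]) (auto simp: 1 2)
qed

lemma has_derivative_vecI:
  fixes f :: "'a::real_normed_vector \<Rightarrow> real^'n"
  assumes "\<And>i. ((\<lambda>p. f p $ i) has_derivative (\<lambda>h. f' h $ i)) (at a within S)"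
  shows "(f has_derivative f') (at a within S)"
  unfolding has_derivative_componentwise_within[of f f']
  using assms by (auto simp: Basis_vec_def inner_axis)

lemma triple_product_linear_image:
  fixes L :: "real^3 \<Rightarrow> real^3"
  assumes "linear L"
  shows "lprod (lcross (L a) (L b)) (L c) = lprod (lcross a b) c * det (matrix L)"
proof -
  have L: "L v = matrix L *v v" for v 
    using assms linear_matrix_vector_mul_eq[of L] matrix_works[of L v] by auto
  have "(vector [L a, L b, L c] :: real^3^3) = vector [a, b, c] ** transpose (matrix L)"
    by (simp add: vec_eq_iff forall_3 matrix_matrix_mult_def sum_3 transpose_def
        L matrix_vector_mult_def mult_ac)
  then show ?thesis
    by (simp add: lprod_lcross det_mul det_transpose)
qed

definition cross_cap_derivative :: "real \<times> real \<Rightarrow> real \<times> real \<Rightarrow> real^3" where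
  "cross_cap_derivative p h = vector [fst h, fst p * snd h + snd p * fst h, 2 * snd p * snd h]"

lemma cross_cap_map_has_derivative:
  "(cross_cap_map has_derivative cross_cap_derivative p) (at p)"
proof (rule has_derivative_vecI)
  fix i :: 3
  show "((\<lambda>p. cross_cap_map p $ i) has_derivative
     (\<lambda>h. cross_cap_derivative p h $ i)) (at p)"
    using exhaust_3[of i] unfolding cross_cap_map_def cross_cap_derivative_def case_prod_unfold
    by (auto intro!: derivative_eq_intros simp: algebra_simps)
qed

lemma linear_sum_axis:
  fixes L :: "real^3 \<Rightarrow> real^3"
  assumes "linear L"
  shows "L v = (\<Sum>i\<in>UNIV. v $ i *\<^sub>R L (axis i 1))"
proof -
  have "L v = L (\<Sum>i\<in>UNIV. v $ i *\<^sub>R axis i 1)"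
    by (simp add: basis_expansion flip: scalar_mult_eq_scaleR)
  then show ?thesis using assms by (simp add: linear_sum linear_scale)
qed

text \<open>Where \<open>h\<close> vanishes, the derivative of \<open>K\<close> does not contribute to the derivative of \<open>K z (h z)\<close>.
  Expanding \<open>h\<close> in the standard basis reduces the claim to the maps \<open>K _ v\<close> for single vectors \<open>v\<close>,
  which is how the second derivatives of a smooth map are available.\<close>

lemma product_rule_at_zero:
  fixes h :: "'a::real_normed_vector \<Rightarrow> real^3" and K :: "'a \<Rightarrow> real^3 \<Rightarrow> real^3"
  assumes h: "(h has_derivative h') (at q)" and h0: "h q = 0"
    and K: "\<And>v. (\<lambda>z. K z v) differentiable (at q)"
    and lin: "\<forall>\<^sub>F z in nhds q. linear (K z)"
  shows "((\<lambda>z. K z (h z)) has_derivative (\<lambda>w. K q (h' w))) (at q)"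
proof -
  have linq: "linear (K q)" using lin by (rule eventually_nhds_x_imp_x)
  have hi: "((\<lambda>z. h z $ i) has_derivative (\<lambda>w. h' w $ i)) (at q)" for i
    by (rule bounded_linear.has_derivative[OF bounded_linear_vec_nth h])
  have Ki: "((\<lambda>z. K z (axis i 1)) has_derivative frechet_derivative (\<lambda>z. K z (axis i 1)) (at q)) (at q)" for i
    by (rule has_derivative_frechet[OF K])
  have "((\<lambda>z. \<Sum>i\<in>UNIV. h z $ i *\<^sub>R K z (axis i 1)) has_derivative
      (\<lambda>w. \<Sum>i\<in>UNIV. h' w $ i *\<^sub>R K q (axis i 1))) (at q)"
    by (rule has_derivative_eq_rhs[OF has_derivative_sum[OF has_derivative_scaleR[OF hi Ki]]])
       (simp add: h0)
  then have D: "((\<lambda>z. \<Sum>i\<in>UNIV. h z $ i *\<^sub>R K z (axis i 1)) has_derivative (\<lambda>w. K q (h' w))) (at q)"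
    by (simp add: linear_sum_axis[OF linq, of "h' _"])
  from lin obtain S where S: "open S" "q \<in> S" "\<And>z. z \<in> S \<Longrightarrow> linear (K z)"
    unfolding eventually_nhds by blast
  show ?thesis
    by (rule has_derivative_transform_within_open[OF D S(1,2)])
       (simp add: linear_sum_axis[OF S(3), of _ "h _"])
qed

lemma eventually_compose_continuous:
  assumes "eventually P (nhds (x q))" "isCont x q"
  shows "\<forall>\<^sub>F z in nhds q. P (x z)"
proof -
  have "filterlim x (nhds (x q)) (nhds q)"
    using assms(2) by (simp add: isCont_def tendsto_at_iff_tendsto_nhds)
  with assms(1) show ?thesis by (auto simp: filterlim_iff)
qed

lemma cross_cap_chain_rule:
  assumes \<phi>: "diffeo_germ \<phi> q b" and \<Psi>: "diffeo_germ \<Psi> (x q) c"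
    and eq: "\<forall>\<^sub>F z in nhds q. \<Psi> (x z) = cross_cap_map (\<phi> z)"
    and dx: "\<forall>\<^sub>F z in nhds q. x differentiable (at z)"
  shows "\<forall>\<^sub>F z in nhds q. \<forall>h.
    frechet_derivative \<Psi> (at (x z)) (frechet_derivative x (at z) h)
    = cross_cap_derivative (\<phi> z) (frechet_derivative \<phi> (at z) h)"
    and "\<forall>\<^sub>F z in nhds q. \<Psi> differentiable (at (x z))"
proof -
  have contx: "isCont x q"
    by (rule differentiable_imp_continuous_within[OF eventually_nhds_x_imp_x[OF dx]])
  show d\<Psi>x: "\<forall>\<^sub>F z in nhds q. \<Psi> differentiable (at (x z))"
    by (rule eventually_compose_continuous[OF diffeo_germ_differentiable(1)[OF \<Psi>] contx])
  note d\<phi> = diffeo_germ_differentiable(1)[OF \<phi>]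
  let ?X = "\<lambda>z. frechet_derivative x (at z)"
  let ?F = "\<lambda>z. frechet_derivative \<phi> (at z)"
  let ?P = "\<lambda>z. frechet_derivative \<Psi> (at (x z))"
  have eq_ev: "\<forall>\<^sub>F z in nhds q. \<forall>\<^sub>F y in nhds z. \<Psi> (x y) = cross_cap_map (\<phi> y)"
    using eq by (simp add: eventually_eventually)
  show "\<forall>\<^sub>F z in nhds q. \<forall>h. ?P z (?X z h) = cross_cap_derivative (\<phi> z) (?F z h)"
    using dx d\<Psi>x d\<phi> eq_ev
  proof eventually_elim
    case (elim z)
    have 1: "((\<lambda>y. \<Psi> (x y)) has_derivative (\<lambda>h. ?P z (?X z h))) (at z)"
      by (rule has_derivative_compose[OF has_derivative_frechet[OF elim(1)] has_derivative_frechet[OF elim(2)]])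
    have 2: "((\<lambda>y. cross_cap_map (\<phi> y)) has_derivative
        (\<lambda>h. cross_cap_derivative (\<phi> z) (?F z h))) (at z)"
      by (rule has_derivative_compose[OF has_derivative_frechet[OF elim(3)] cross_cap_map_has_derivative])
    from elim(4) obtain S where S: "open S" "z \<in> S" "\<And>y. y \<in> S \<Longrightarrow> \<Psi> (x y) = cross_cap_map (\<phi> y)"
      unfolding eventually_nhds by blast
    have "((\<lambda>y. \<Psi> (x y)) has_derivative (\<lambda>h. cross_cap_derivative (\<phi> z) (?F z h))) (at z)"
      by (rule has_derivative_transform_within_open[OF 2 S(1,2)]) (simp add: S(3))
    with 1 have "(\<lambda>h. ?P z (?X z h)) = (\<lambda>h. cross_cap_derivative (\<phi> z) (?F z h))"
      by (rule has_derivative_unique)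
    then show ?case by (simp add: fun_eq_iff)
  qed
qed

lemma cross_cap_derivative_origin:
  "cross_cap_derivative (0, 0) h = vector [fst h, 0, 0]"
  by (simp add: cross_cap_derivative_def)

lemma cross_cap_germ_derivative_nonzero:
  assumes cc: "cross_cap_germ x q"
    and dx: "\<forall>\<^sub>F z in nhds q. x differentiable (at z)"
  obtains h where "frechet_derivative x (at q) h \<noteq> 0"
proof -
  from cc obtain \<phi> \<Psi> where \<phi>: "diffeo_germ \<phi> q (0, 0)" and \<Psi>: "diffeo_germ \<Psi> (x q) 0"
    and eq: "\<forall>\<^sub>F z in nhds q. \<Psi> (x z) = cross_cap_map (\<phi> z)"
    unfolding cross_cap_germ_def by blast
  have \<phi>q: "\<phi> q = (0, 0)" using \<phi> by (simp add: diffeo_germ_def)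
  note chain = cross_cap_chain_rule[OF \<phi> \<Psi> eq dx]
  obtain \<eta> where \<eta>: "frechet_derivative \<phi> (at q) \<eta> = (1, 0)"
    using diffeo_germ_derivative_bij[OF \<phi>] by (metis bij_pointE)
  have "frechet_derivative \<Psi> (at (x q)) (frechet_derivative x (at q) \<eta>)
      = vector [1, 0, 0]"
    using spec[OF eventually_nhds_x_imp_x[OF chain(1)], of \<eta>]
    by (simp only: \<phi>q \<eta> cross_cap_derivative_origin fst_conv)
  moreover have "frechet_derivative \<Psi> (at (x q)) 0 = 0"
    by (rule linear_0[OF linear_frechet_derivative[OF eventually_nhds_x_imp_x[OF chain(2)]]])
  moreover have "(vector [1, 0, 0] :: real^3) \<noteq> 0" by (simp add: vec_eq_iff forall_3)
  ultimately have "frechet_derivative x (at q) \<eta> \<noteq> 0" by auto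
  then show ?thesis by (rule that)
qed

text \<open>Whitney's criterion for cross-caps, in coordinates with \<open>x_u \<noteq> 0\<close>. For the normal form
  \<open>(s, s t, t\<^sup>2)\<close> itself the kernel direction is the second coordinate, and the derivative along it
  is \<open>(0, s, 2 t)\<close>, whose partial derivatives \<open>(0, 1, 0)\<close> and \<open>(0, 0, 2)\<close> together with
  \<open>x_s = (1, 0, 0)\<close> form a basis. The proof carries this through the diffeomorphisms.\<close>

lemma cross_cap_germ_nondegenerate:
  assumes cc: "cross_cap_germ x q"
    and dx: "\<forall>\<^sub>F z in nhds q. x differentiable (at z)"
    and du: "d_u x differentiable (at q)" and dv: "d_v x differentiable (at q)"
    and u0: "d_u x q \<noteq> 0"
  obtains \<mu> where "d_v x q = \<mu> *\<^sub>R d_u x q"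
    "lprod (lcross (d_u x q) (d_u (d_v x) q - \<mu> *\<^sub>R d_u (d_u x) q))
       (d_v (d_v x) q - \<mu> *\<^sub>R d_v (d_u x) q) \<noteq> 0"
proof -
  from cc obtain \<phi> \<Psi> where \<phi>: "diffeo_germ \<phi> q (0, 0)" and \<Psi>: "diffeo_germ \<Psi> (x q) 0"
    and eq: "\<forall>\<^sub>F z in nhds q. \<Psi> (x z) = cross_cap_map (\<phi> z)"
    unfolding cross_cap_germ_def by blast
  have \<phi>q: "\<phi> q = (0, 0)" using \<phi> by (simp add: diffeo_germ_def)
  have dxq: "x differentiable (at q)" using dx by (rule eventually_nhds_x_imp_x)
  note chain = cross_cap_chain_rule(1)[OF \<phi> \<Psi> eq dx]
  note d\<Psi>x = cross_cap_chain_rule(2)[OF \<phi> \<Psi> eq dx]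
  note d\<phi> = diffeo_germ_differentiable(1)[OF \<phi>]
  let ?X = "\<lambda>z. frechet_derivative x (at z)"
  let ?F = "\<lambda>z. frechet_derivative \<phi> (at z)"
  let ?P = "\<lambda>z. frechet_derivative \<Psi> (at (x z))"
  let ?C = "cross_cap_derivative"
  have linX: "linear (?X q)" by (rule linear_frechet_derivative[OF dxq])
  have linF: "linear (?F q)"
    by (rule linear_frechet_derivative[OF eventually_nhds_x_imp_x[OF d\<phi>]])
  have linP: "linear (?P q)"
    by (rule linear_frechet_derivative[OF eventually_nhds_x_imp_x[OF d\<Psi>x]])
  have bijF: "bij (?F q)" and bijP: "bij (?P q)"
    using diffeo_germ_derivative_bij \<phi> \<Psi> by blast+
  have chq: "?P q (?X q h) = vector [fst (?F q h), 0, 0]" for h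
    using spec[OF eventually_nhds_x_imp_x[OF chain], of h] by (simp only: \<phi>q cross_cap_derivative_origin)
  have Xuv: "?X q (a, b) = a *\<^sub>R d_u x q + b *\<^sub>R d_v x q" for a b
    using linear_add[OF linX, of "(a, 0)" "(0, b)"] linear_scale[OF linX, of a "(1, 0)"]
      linear_scale[OF linX, of b "(0, 1)"]
    by (simp add: d_u_def d_v_def)
  \<comment> \<open>\<open>\<eta>\<close> spans the kernel of the derivative of \<open>x\<close>; rescaling it so that its second component is
    \<open>1\<close>, which \<open>d_u x q \<noteq> 0\<close> permits, gives \<open>(- \<mu>, 1)\<close>.\<close>
  obtain \<eta> where \<eta>: "?F q \<eta> = (0, 1)" using bijF by (metis bij_pointE)
  have "?P q (?X q \<eta>) = 0" unfolding chq \<eta> by (simp add: vec_eq_iff forall_3)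
  also have "0 = ?P q 0" using linP by (simp add: linear_0)
  finally have "?X q \<eta> = 0" using bijP by (meson bij_is_inj injD)
  then have null: "fst \<eta> *\<^sub>R d_u x q + snd \<eta> *\<^sub>R d_v x q = 0"
    using Xuv[of "fst \<eta>" "snd \<eta>"] by simp
  have b: "snd \<eta> \<noteq> 0"
  proof
    assume "snd \<eta> = 0"
    with null u0 have "\<eta> = 0" by (simp add: prod_eq_iff)
    with \<eta> linear_0[OF linF] show False by (simp add: zero_prod_def)
  qed
  define \<mu> where "\<mu> = - fst \<eta> / snd \<eta>"
  define c where "c = 1 / snd \<eta>"
  have c: "c \<noteq> 0" using b by (simp add: c_def)
  have \<mu>v: "d_v x q = \<mu> *\<^sub>R d_u x q"
  proof -
    have "snd \<eta> *\<^sub>R d_v x q = snd \<eta> *\<^sub>R (\<mu> *\<^sub>R d_u x q)"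
      using null b by (simp add: \<mu>_def add_eq_0_iff)
    with b show ?thesis by (simp only: scaleR_cancel_left) simp
  qed
  have F\<eta>: "?F q (- \<mu>, 1) = (0, c)"
  proof -
    have "(- \<mu>, 1) = c *\<^sub>R \<eta>" using b by (simp add: prod_eq_iff \<mu>_def c_def)
    then show ?thesis using linear_scale[OF linF, of c \<eta>] by (simp add: \<eta>)
  qed
  \<comment> \<open>\<open>h\<close> is the derivative of \<open>x\<close> along the constant field \<open>(- \<mu>, 1)\<close>, and \<open>\<alpha>\<close> is the derivative of \<open>\<phi>\<close>
    along it. Since \<open>h\<close> vanishes at \<open>q\<close>, the second derivative of \<open>\<Psi>\<close> drops out of \<open>D1\<close>.\<close>
  define h where "h = (\<lambda>z. d_v x z - \<mu> *\<^sub>R d_u x z)"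
  define h' where "h' = (\<lambda>w. frechet_derivative (d_v x) (at q) w - \<mu> *\<^sub>R frechet_derivative (d_u x) (at q) w)"
  have h: "(h has_derivative h') (at q)" unfolding h_def h'_def
    by (intro has_derivative_diff has_derivative_scaleR_right has_derivative_frechet du dv)
  have h0: "h q = 0" by (simp add: h_def \<mu>v)
  define \<alpha> where "\<alpha> = (\<lambda>z. ?F z (- \<mu>, 1))"
  define \<alpha>' where "\<alpha>' = frechet_derivative \<alpha> (at q)"
  have \<alpha>: "(\<alpha> has_derivative \<alpha>') (at q)"
    unfolding \<alpha>'_def by (rule has_derivative_frechet) (simp add: \<alpha>_def diffeo_germ_differentiable(2)[OF \<phi>])
  have \<alpha>q: "\<alpha> q = (0, c)" by (simp add: \<alpha>_def F\<eta>)
  have D1: "((\<lambda>z. ?P z (h z)) has_derivative (\<lambda>w. ?P q (h' w))) (at q)"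
  proof (rule product_rule_at_zero[OF h h0])
    show "(\<lambda>z. ?P z v) differentiable (at q)" for v
      using differentiable_compose[OF diffeo_germ_differentiable(2)[OF \<Psi>] dxq] .
    show "\<forall>\<^sub>F z in nhds q. linear (?P z)"
      using d\<Psi>x by eventually_elim (rule linear_frechet_derivative)
  qed
  have D\<phi>: "(\<phi> has_derivative ?F q) (at q)"
    by (rule has_derivative_frechet[OF eventually_nhds_x_imp_x[OF d\<phi>]])
  have D2: "((\<lambda>z. ?C (\<phi> z) (\<alpha> z)) has_derivative
      (\<lambda>w. vector [fst (\<alpha>' w), c * fst (?F q w), 2 * c * snd (?F q w)])) (at q)"
  proof (rule has_derivative_vecI)
    fix i :: 3
    show "((\<lambda>z. ?C (\<phi> z) (\<alpha> z) $ i) has_derivative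
      (\<lambda>w. vector [fst (\<alpha>' w), c * fst (?F q w), 2 * c * snd (?F q w)] $ i)) (at q)"
      using exhaust_3[of i] unfolding cross_cap_derivative_def
      by (auto intro!: derivative_eq_intros \<alpha> D\<phi> simp: \<alpha>q \<phi>q algebra_simps)
  qed
  have "\<forall>\<^sub>F z in nhds q. ?P z (h z) = ?C (\<phi> z) (\<alpha> z)"
    using chain dx
  proof eventually_elim
    case (elim z)
    have lin: "linear (?X z)" by (rule linear_frechet_derivative[OF elim(2)])
    have "?X z (- \<mu>, 1) = h z"
      using linear_diff[OF lin, of "(0, 1)" "\<mu> *\<^sub>R (1, 0)"] linear_scale[OF lin, of \<mu> "(1, 0)"]
      by (simp add: d_u_def d_v_def h_def)
    with elim(1) show ?case unfolding \<alpha>_def by metis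
  qed
  then obtain S where S: "open S" "q \<in> S" "\<And>z. z \<in> S \<Longrightarrow> ?P z (h z) = ?C (\<phi> z) (\<alpha> z)"
    unfolding eventually_nhds by blast
  have "((\<lambda>z. ?P z (h z)) has_derivative
      (\<lambda>w. vector [fst (\<alpha>' w), c * fst (?F q w), 2 * c * snd (?F q w)])) (at q)"
    by (rule has_derivative_transform_within_open[OF D2 S(1,2)]) (simp add: S(3))
  note eqD = has_derivative_unique[OF D1 this]
  have Ph: "?P q (h' w) = vector [fst (\<alpha>' w), c * fst (?F q w), 2 * c * snd (?F q w)]" for w
    by (rule fun_cong[OF eqD])
  \<comment> \<open>The derivative of \<open>\<Psi>\<close> sends \<open>d_u x q\<close> to \<open>(a, 0, 0)\<close>. In the last two components of its values at
    \<open>h' (1, 0)\<close> and \<open>h' (0, 1)\<close> stand \<open>c\<close> and \<open>2 * c\<close> times the partial derivatives of the components of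
    \<open>\<phi>\<close>. So the triple product of the images is \<open>2 * c\<^sup>2 * a\<close> times the Jacobian determinant \<open>a * c\<close> of \<open>\<phi>\<close>.\<close>
  define a where "a = fst (?F q (1, 0))"
  define r where "r = snd (?F q (1, 0))"
  have Fu: "?F q (1, 0) = (a, r)" by (simp add: a_def r_def)
  have Fv: "?F q (0, 1) = (\<mu> * a, c + \<mu> * r)"
    using linear_add[OF linF, of "(- \<mu>, 1)" "\<mu> *\<^sub>R (1, 0)"] linear_scale[OF linF, of \<mu> "(1, 0)"]
    by (simp add: F\<eta> Fu)
  have a: "a \<noteq> 0"
  proof
    assume "a = 0"
    then have "?F q (1, 0) = ?F q ((r / c) *\<^sub>R (- \<mu>, 1))"
      using c by (simp only: Fu linear_scale[OF linF] F\<eta>) simp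
    then have "(1, 0) = (r / c) *\<^sub>R (- \<mu>, 1 :: real)" using bijF by (meson bij_is_inj injD)
    then show False using c by auto
  qed
  have "lprod (lcross (?P q (d_u x q)) (?P q (h' (1, 0)))) (?P q (h' (0, 1))) = 2 * c ^ 3 * a ^ 2"
  proof -
    have "?P q (d_u x q) = vector [a, 0, 0]" using chq[of "(1, 0)"] by (simp add: d_u_def Fu)
    then show ?thesis
      unfolding Ph Fu Fv
      by (simp add: lprod_def lcross_def algebra_simps power2_eq_square power3_eq_cube)
  qed
  then have "lprod (lcross (d_u x q) (h' (1, 0))) (h' (0, 1)) \<noteq> 0"
    unfolding triple_product_linear_image[OF linP] using a c by auto
  with \<mu>v show ?thesis
    by (intro that[of \<mu>]) (simp_all add: h'_def d_u_def d_v_def)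
qed

section \<open>The Jacobian of the coefficients b and c\<close>

lemma has_series_vec_derivs:
  fixes x :: "real \<times> real \<Rightarrow> real^3" and X :: "3 \<Rightarrow> real fps fps"
  assumes X: "\<And>i. has_series (\<lambda>z. x z $ i) q (X i)"
  shows "\<forall>\<^sub>F z in nhds q. x differentiable (at z)"
    and "\<And>i. has_series (\<lambda>z. d_u x z $ i) q (series_ds (X i))"
    and "\<And>i. has_series (\<lambda>z. d_v x z $ i) q (series_dt (X i))"
proof -
  define R where "R i P Q \<longleftrightarrow> has_series P q (series_ds (X i)) \<and> has_series Q q (series_dt (X i)) \<and>
    (\<forall>\<^sub>F w in nhds q. ((\<lambda>z. x z $ i) has_derivative (\<lambda>h. P w * fst h + Q w * snd h)) (at w))"
    for i P Q
  have "\<exists>P Q. R i P Q" for i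
    unfolding R_def by (rule has_series_has_derivative[OF X[of i]]) blast
  then obtain P Q where PQ: "\<And>i. R i (P i) (Q i)" by metis
  then have P: "\<And>i. has_series (P i) q (series_ds (X i))"
    and Q: "\<And>i. has_series (Q i) q (series_dt (X i))"
    and d: "\<And>i. \<forall>\<^sub>F w in nhds q. ((\<lambda>z. x z $ i) has_derivative (\<lambda>h. P i w * fst h + Q i w * snd h)) (at w)"
    unfolding R_def by blast+
  have D: "\<forall>\<^sub>F w in nhds q. (x has_derivative (\<lambda>h. \<chi> i. P i w * fst h + Q i w * snd h)) (at w)"
  proof -
    have "\<forall>\<^sub>F w in nhds q. \<forall>i. ((\<lambda>z. x z $ i) has_derivative (\<lambda>h. P i w * fst h + Q i w * snd h)) (at w)"
      by (rule eventually_all_finite) (rule d)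
    then show ?thesis by eventually_elim (rule has_derivative_vecI, simp)
  qed
  then show "\<forall>\<^sub>F z in nhds q. x differentiable (at z)"
    by eventually_elim (auto simp: differentiable_def)
  have F: "\<forall>\<^sub>F w in nhds q. frechet_derivative x (at w) = (\<lambda>h. \<chi> i. P i w * fst h + Q i w * snd h)"
    using D by eventually_elim (rule frechet_derivative_at[symmetric])
  have "\<forall>\<^sub>F w in nhds q. d_u x w $ i = P i w" for i
    using F by eventually_elim (simp add: d_u_def)
  then show "has_series (\<lambda>z. d_u x z $ i) q (series_ds (X i))" for i
    using has_series_cong[of "\<lambda>w. d_u x w $ i" "P i" q] P[of i] by simp
  have "\<forall>\<^sub>F w in nhds q. d_v x w $ i = Q i w" for i
    using F by eventually_elim (simp add: d_v_def)
  then show "has_series (\<lambda>z. d_v x z $ i) q (series_dt (X i))" for i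
    using has_series_cong[of "\<lambda>w. d_v x w $ i" "Q i" q] Q[of i] by simp
qed

definition series_prod :: "(3 \<Rightarrow> real fps fps) \<Rightarrow> (3 \<Rightarrow> real fps fps) \<Rightarrow> real fps fps" where
  "series_prod U V = U 1 * V 1 + U 2 * V 2 - U 3 * V 3"

definition series_cross ::
    "(3 \<Rightarrow> real fps fps) \<Rightarrow> (3 \<Rightarrow> real fps fps) \<Rightarrow> 3 \<Rightarrow> real fps fps" where
  "series_cross U V i =
     (if i = 1 then U 2 * V 3 - U 3 * V 2
      else if i = 2 then U 3 * V 1 - U 1 * V 3
      else U 2 * V 1 - U 1 * V 2)"

lemma has_series_lprod:
  assumes "\<And>i. has_series (\<lambda>z. f z $ i) q (U i)" "\<And>i. has_series (\<lambda>z. g z $ i) q (V i)"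
  shows "has_series (\<lambda>z. lprod (f z) (g z)) q (series_prod U V)"
  unfolding lprod_def series_prod_def
  by (intro has_series_add has_series_diff has_series_mult assms)

lemma has_series_lcross:
  assumes "\<And>i. has_series (\<lambda>z. f z $ i) q (U i)" "\<And>i. has_series (\<lambda>z. g z $ i) q (V i)"
  shows "has_series (\<lambda>z. lcross (f z) (g z) $ i) q (series_cross U V i)"
  using exhaust_3[of i] unfolding lcross_def series_cross_def
  by (auto intro!: has_series_diff has_series_mult assms)

text \<open>For a vector of series, \<open>jet 0 0\<close> is the value at the centre, and \<open>jet 1 0\<close>, \<open>jet 0 1\<close> are the
  partial derivatives there.\<close>

definition jet :: "nat \<Rightarrow> nat \<Rightarrow> (3 \<Rightarrow> real fps fps) \<Rightarrow> real^3" where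
  "jet i j U = (\<chi> k. coeff2 (U k) i j)"

lemma coeff2_series_prod:
  "coeff2 (series_prod U V) 0 0 = lprod (jet 0 0 U) (jet 0 0 V)"
  "coeff2 (series_prod U V) 1 0 = lprod (jet 1 0 U) (jet 0 0 V) + lprod (jet 0 0 U) (jet 1 0 V)"
  "coeff2 (series_prod U V) 0 1 = lprod (jet 0 1 U) (jet 0 0 V) + lprod (jet 0 0 U) (jet 0 1 V)"
  by (simp_all add: series_prod_def lprod_def jet_def fps_mult_nth_1 algebra_simps)

lemma jet_series_cross:
  "jet 0 0 (series_cross U V) = lcross (jet 0 0 U) (jet 0 0 V)"
  "jet 1 0 (series_cross U V) = lcross (jet 1 0 U) (jet 0 0 V) + lcross (jet 0 0 U) (jet 1 0 V)"
  "jet 0 1 (series_cross U V) = lcross (jet 0 1 U) (jet 0 0 V) + lcross (jet 0 0 U) (jet 0 1 V)"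
  by (simp_all add: vec_eq_iff forall_3 series_cross_def lcross_def jet_def fps_mult_nth_1 algebra_simps)

lemma jet_eq_value:
  assumes "\<And>i. has_series (\<lambda>z. f z $ i) q (U i)"
  shows "jet 0 0 U = f q"
  using has_series_at_center[OF assms] by (simp add: vec_eq_iff jet_def)

lemma lprod_scaleR [simp]: "lprod (c *\<^sub>R a) b = c * lprod a b" "lprod a (c *\<^sub>R b) = c * lprod a b"
  and lprod_zero [simp]: "lprod 0 b = 0"
  by (simp_all add: lprod_def algebra_simps)

text \<open>Since \<open>v - \<mu> u = P\<close> and \<open>w - \<mu>\<^sup>2 u = Q + \<mu> P\<close>, linearity in the last argument turns the left-hand
  sides into triple products of \<open>a\<close>, \<open>P\<close>, \<open>Q\<close>, and the triple product is alternating.\<close>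

lemma jacobian_identities:
  fixes a u v w :: "real^3" and \<mu> :: real
  defines "P \<equiv> v - \<mu> *\<^sub>R u" and "Q \<equiv> w - \<mu> *\<^sub>R v"
  shows "lprod (lcross a P) w - \<mu>\<^sup>2 * lprod (lcross a P) u = lprod (lcross a P) Q"
    and "lprod (lcross a P) v - \<mu> * lprod (lcross a P) u = 0"
    and "lprod (lcross a Q) v - \<mu> * lprod (lcross a Q) u = - lprod (lcross a P) Q"
  unfolding P_def Q_def lprod_def lcross_def
  by (simp_all add: algebra_simps power2_eq_square)

text \<open>The Jacobian matrix of \<open>(b, c)\<close> at \<open>q\<close> is upper triangular with the diagonal entries \<open>e D\<close> and
  \<open>- e D\<close>, where \<open>e = E\<close> at \<open>q\<close> and \<open>D\<close> is the triple product of Whitney's criterion.\<close>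

lemma m_u_cross_cap:
  assumes x: "analytic_cross_cap x q M p" and E0: "coeff_E x q \<noteq> 0"
  shows "m_u x q = 1"
proof -
  have "\<exists>A. has_series (\<lambda>z. x z $ i) q A" for i
    using x unfolding analytic_cross_cap_def analytic2_at_iff_has_series by blast
  then obtain X where X: "\<And>i. has_series (\<lambda>z. x z $ i) q (X i)" by metis
  define Xu where "Xu = (\<lambda>i. series_ds (X i))"
  define Xv where "Xv = (\<lambda>i. series_dt (X i))"
  have u: "has_series (\<lambda>z. d_u x z $ i) q (Xu i)" and v: "has_series (\<lambda>z. d_v x z $ i) q (Xv i)" for i
    unfolding Xu_def Xv_def using has_series_vec_derivs[OF X] by blast+
  define Xuu where "Xuu = (\<lambda>i. series_ds (Xu i))"
  define Xuv where "Xuv = (\<lambda>i. series_dt (Xu i))"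
  define Xvv where "Xvv = (\<lambda>i. series_dt (Xv i))"
  have uu: "has_series (\<lambda>z. d_u (d_u x) z $ i) q (Xuu i)"
    and uv: "has_series (\<lambda>z. d_v (d_u x) z $ i) q (Xuv i)"
    and vv: "has_series (\<lambda>z. d_v (d_v x) z $ i) q (Xvv i)"
    and vu: "has_series (\<lambda>z. d_u (d_v x) z $ i) q (series_ds (Xv i))" for i
    unfolding Xuu_def Xuv_def Xvv_def
    using has_series_vec_derivs[OF u] has_series_vec_derivs[OF v] by blast+
  have du: "d_u x differentiable (at q)" and dv: "d_v x differentiable (at q)"
    using has_series_vec_derivs(1)[OF u] has_series_vec_derivs(1)[OF v]
    by (auto dest: eventually_nhds_x_imp_x)
  define a where "a = d_u x q"
  define U where "U = d_u (d_u x) q"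
  define V where "V = d_v (d_u x) q"
  define W where "W = d_v (d_v x) q"
  have j00: "jet 0 0 Xu = a" "jet 0 0 Xv = d_v x q" "jet 0 0 Xuu = U" "jet 0 0 Xuv = V" "jet 0 0 Xvv = W"
    unfolding a_def U_def V_def W_def
    using jet_eq_value[OF u] jet_eq_value[OF v] jet_eq_value[OF uu] jet_eq_value[OF uv] jet_eq_value[OF vv]
    by auto
  \<comment> \<open>Mixed partial derivatives agree already as formal series.\<close>
  have swap: "series_ds (Xv i) = Xuv i" for i
    by (intro coeff2_eqI) (simp add: Xuv_def Xu_def Xv_def)
  have vuV: "d_u (d_v x) q = V"
    using jet_eq_value[OF vu] j00(4) by (simp add: swap)
  have j1: "jet 1 0 Xu = U" "jet 0 1 Xu = V" "jet 1 0 Xv = V" "jet 0 1 Xv = W"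
    unfolding j00(3,4,5)[symmetric]
    by (simp_all add: jet_def Xuu_def Xuv_def Xvv_def Xu_def Xv_def)
  have a0: "a \<noteq> 0" using E0 by (auto simp: coeff_E_def a_def)
  have "cross_cap_germ x q" using x by (simp add: analytic_cross_cap_def)
  from cross_cap_germ_nondegenerate[OF this has_series_vec_derivs(1)[OF X] du dv] a0
  obtain \<mu> where \<mu>: "d_v x q = \<mu> *\<^sub>R a"
    and nondeg: "lprod (lcross a (V - \<mu> *\<^sub>R U)) (W - \<mu> *\<^sub>R V) \<noteq> 0"
    unfolding a_def vuV U_def[symmetric] V_def[symmetric] W_def[symmetric] by blast
  define P where "P = V - \<mu> *\<^sub>R U"
  define Q where "Q = W - \<mu> *\<^sub>R V"
  define D where "D = lprod (lcross a P) Q"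
  define e where "e = lprod a a"
  have D0: "D \<noteq> 0" using nondeg by (simp add: D_def P_def Q_def)
  have e0: "e \<noteq> 0" using E0 by (simp add: e_def coeff_E_def a_def)
  define N where "N = series_cross Xu Xv"
  have N: "has_series (\<lambda>z. lcross (d_u x z) (d_v x z) $ i) q (N i)" for i
    unfolding N_def by (intro has_series_lcross u v)
  have jN: "jet 0 0 N = 0" "jet 1 0 N = lcross a P" "jet 0 1 N = lcross a Q"
    unfolding N_def jet_series_cross j00 j1 \<mu> P_def Q_def
    by (simp_all add: vec_eq_iff forall_3 lcross_def algebra_simps)
  define B where "B = series_prod Xu Xu * series_prod N Xvv - series_prod Xv Xv * series_prod N Xuu"
  define C where "C = series_prod Xu Xu * series_prod N Xuv - series_prod Xu Xv * series_prod N Xuu"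
  have B: "has_series (coeff_b x) q B"
    unfolding B_def coeff_b_def[abs_def] coeff_E_def coeff_n_def coeff_G_def coeff_l_def
    by (intro has_series_diff has_series_mult has_series_lprod N u v uu vv)
  have C: "has_series (coeff_c x) q C"
    unfolding C_def coeff_c_def[abs_def] coeff_E_def coeff_m_def coeff_F_def coeff_l_def
    by (intro has_series_diff has_series_mult has_series_lprod N u v uu uv)
  have prod0: "coeff2 (series_prod Xu Xu) 0 0 = e" "coeff2 (series_prod Xu Xv) 0 0 = \<mu> * e"
    "coeff2 (series_prod Xv Xv) 0 0 = \<mu>\<^sup>2 * e"
    by (simp_all add: coeff2_series_prod j00 \<mu> e_def power2_eq_square)
  have B0: "coeff2 B 0 0 = 0" and C0: "coeff2 C 0 0 = 0"
    by (simp_all add: B_def C_def coeff2_series_prod jN)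
  \<comment> \<open>As \<open>series_prod N Y\<close> has no constant term, the derivatives of \<open>F\<close> and \<open>Y\<close> do not enter.\<close>
  have lin: "coeff2 (F * series_prod N Y - G * series_prod N Z) 1 0
      = coeff2 F 0 0 * lprod (lcross a P) (jet 0 0 Y) - coeff2 G 0 0 * lprod (lcross a P) (jet 0 0 Z)"
    "coeff2 (F * series_prod N Y - G * series_prod N Z) 0 1
      = coeff2 F 0 0 * lprod (lcross a Q) (jet 0 0 Y) - coeff2 G 0 0 * lprod (lcross a Q) (jet 0 0 Z)" for F G Y Z
    by (simp_all add: fps_mult_nth_1 coeff2_series_prod[unfolded One_nat_def] jN[unfolded One_nat_def])
  have id: "lprod (lcross a P) W - \<mu>\<^sup>2 * lprod (lcross a P) U = D"
    "lprod (lcross a P) V - \<mu> * lprod (lcross a P) U = 0"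
    "lprod (lcross a Q) V - \<mu> * lprod (lcross a Q) U = - D"
    unfolding D_def P_def Q_def by (rule jacobian_identities)+
  have "coeff2 B 1 0 = e * (lprod (lcross a P) W - \<mu>\<^sup>2 * lprod (lcross a P) U)"
    unfolding B_def lin prod0 j00 by (simp add: algebra_simps)
  then have B1: "coeff2 B 1 0 = e * D" by (simp only: id)
  have "coeff2 C 1 0 = e * (lprod (lcross a P) V - \<mu> * lprod (lcross a P) U)"
    unfolding C_def lin prod0 j00 by (simp add: algebra_simps)
  then have C1: "coeff2 C 1 0 = 0" by (simp only: id mult_zero_right)
  have "coeff2 C 0 1 = e * (lprod (lcross a Q) V - \<mu> * lprod (lcross a Q) U)"
    unfolding C_def lin prod0 j00 by (simp add: algebra_simps)
  then have C2: "coeff2 C 0 1 = - (e * D)" by (simp only: id mult_minus_right)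
  show ?thesis
  proof (rule m_u_eq_1[OF B C])
    show "coeff_b x q = 0" "coeff_c x q = 0"
      using has_series_at_center[OF B] has_series_at_center[OF C] B0 C0 by simp_all
    show "coeff2 B 1 0 * coeff2 C 0 1 - coeff2 B 0 1 * coeff2 C 1 0 \<noteq> 0"
      unfolding B1 C1 C2 using e0 D0 by simp
  qed
qed

section \<open>Interchanging the coordinates\<close>

lemma Ck_on_cong:
  assumes "open S" "\<And>p. p \<in> S \<Longrightarrow> f p = g p" "Ck_on k f S"
  shows "Ck_on k g S"
  using assms(2,3)
proof (induction k arbitrary: f g)
  case 0
  then show ?case using continuous_on_cong[of S S f g] by simp
next
  case (Suc k)
  have "g differentiable (at p)" if "p \<in> S" for p
    using Suc.prems that assms(1) has_derivative_transform_within_open[of f _ p UNIV S g]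
    unfolding differentiable_def Ck_on.simps by blast
  moreover have "Ck_on k (\<lambda>p. frechet_derivative g (at p) w) S" for w
  proof (rule Suc.IH)
    show "Ck_on k (\<lambda>p. frechet_derivative f (at p) w) S" using Suc.prems by simp
    show "frechet_derivative f (at p) w = frechet_derivative g (at p) w" if "p \<in> S" for p
      using frechet_derivative_transform_within_open[of f p S g] Suc.prems that assms(1) by simp
  qed
  ultimately show ?case by simp
qed

lemma Ck_on_compose_linear:
  assumes L: "bounded_linear L" and S: "open S"
  shows "Ck_on k f S \<Longrightarrow> Ck_on k (\<lambda>p. f (L p)) (L -` S)"
proof (induction k arbitrary: f)
  case 0
  then have "continuous_on S f" by simp
  from continuous_on_compose2[OF this linear_continuous_on[OF L], of "L -` S"]
  show ?case by simp
next
  case (Suc k)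
  have D: "((\<lambda>p. f (L p)) has_derivative (\<lambda>w. frechet_derivative f (at (L p)) (L w))) (at p)"
    if "p \<in> L -` S" for p
    using Suc.prems that
    by (intro has_derivative_compose[of L L p UNIV f] bounded_linear_imp_has_derivative L
          has_derivative_frechet) auto
  have op: "open (L -` S)"
    using S L by (intro continuous_open_vimage linear_continuous_at) auto
  have eq: "frechet_derivative f (at (L p)) (L w) = frechet_derivative (\<lambda>p. f (L p)) (at p) w"
    if "p \<in> L -` S" for p w
    by (rule fun_cong[OF frechet_derivative_at[OF D[OF that]]])
  have "Ck_on k (\<lambda>p. frechet_derivative f (at (L p)) (L w)) (L -` S)" for w
    by (rule Suc.IH) (use Suc.prems in simp)
  from Ck_on_cong[OF op eq this]
  have "Ck_on k (\<lambda>p. frechet_derivative (\<lambda>p. f (L p)) (at p) w) (L -` S)" for w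
    by simp
  moreover have "(\<lambda>p. f (L p)) differentiable (at p)" if "p \<in> L -` S" for p
    by (rule differentiableI[OF D[OF that]])
  ultimately show ?case by simp
qed

lemma Ck_on_linear_compose:
  assumes L: "bounded_linear L" and S: "open S"
  shows "Ck_on k f S \<Longrightarrow> Ck_on k (\<lambda>p. L (f p)) S"
proof (induction k arbitrary: f)
  case 0
  then have "continuous_on S f" by simp
  from continuous_on_compose2[OF linear_continuous_on[OF L, of UNIV] this]
  show ?case by simp
next
  case (Suc k)
  have D: "((\<lambda>p. L (f p)) has_derivative (\<lambda>w. L (frechet_derivative f (at p) w))) (at p)"
    if "p \<in> S" for p
    using Suc.prems that
    by (intro bounded_linear.has_derivative[OF L] has_derivative_frechet) auto
  have eq: "L (frechet_derivative f (at p) w) = frechet_derivative (\<lambda>p. L (f p)) (at p) w"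
    if "p \<in> S" for p w
    by (rule fun_cong[OF frechet_derivative_at[OF D[OF that]]])
  have "Ck_on k (\<lambda>p. L (frechet_derivative f (at p) w)) S" for w
    by (rule Suc.IH) (use Suc.prems in simp)
  from Ck_on_cong[OF S eq this]
  have "Ck_on k (\<lambda>p. frechet_derivative (\<lambda>p. L (f p)) (at p) w) S" for w
    by simp
  moreover have "(\<lambda>p. L (f p)) differentiable (at p)" if "p \<in> S" for p
    by (rule differentiableI[OF D[OF that]])
  ultimately show ?case by simp
qed

lemma bounded_linear_swap:
  "bounded_linear (prod.swap :: 'a::real_normed_vector \<times> 'b::real_normed_vector \<Rightarrow> 'b \<times> 'a)"
  unfolding prod.swap_def by (intro bounded_linear_Pair bounded_linear_fst bounded_linear_snd)

lemma open_vimage_swap: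
  "open (S :: ('a::real_normed_vector \<times> 'b::real_normed_vector) set) \<Longrightarrow> open (prod.swap -` S)"
  using bounded_linear_swap by (intro continuous_open_vimage linear_continuous_at) auto

lemma diffeo_germ_swap:
  assumes "diffeo_germ \<phi> q b"
  shows "diffeo_germ (\<lambda>z. \<phi> (prod.swap z)) (prod.swap q) b"
proof -
  from assms obtain U V g where *: "\<phi> q = b" "open U" "q \<in> U" "open V" "b \<in> V"
    "homeomorphism U V \<phi> g" "smooth_on \<phi> U" "smooth_on g V"
    unfolding diffeo_germ_def by blast
  have "homeomorphism (prod.swap -` U) V (\<lambda>z. \<phi> (prod.swap z)) (\<lambda>r. prod.swap (g r))"
  proof -
    have "homeomorphism (prod.swap -` U) U prod.swap prod.swap"
      by (rule homeomorphismI) (auto intro!: linear_continuous_on bounded_linear_swap)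
    from homeomorphism_compose[OF this *(6)] show ?thesis by (simp add: o_def)
  qed
  moreover have "smooth_on (\<lambda>z. \<phi> (prod.swap z)) (prod.swap -` U)"
    using *(7) Ck_on_compose_linear[OF bounded_linear_swap *(2)] unfolding smooth_on_def by blast
  moreover have "smooth_on (\<lambda>r. prod.swap (g r)) V"
    using *(8) Ck_on_linear_compose[OF bounded_linear_swap *(4)] unfolding smooth_on_def by blast
  ultimately show ?thesis
    unfolding diffeo_germ_def using * open_vimage_swap[OF *(2)]
    by (intro conjI exI[of _ "prod.swap -` U"] exI[of _ V] exI[of _ "\<lambda>r. prod.swap (g r)"]) auto
qed

lemma analytic2_at_swap:
  assumes "analytic2_at f z"
  shows "analytic2_at (\<lambda>w. f (prod.swap w)) (prod.swap z)"
proof -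
  from assms obtain a r where r: "r > 0" and s: "\<And>s t. norm s < r \<Longrightarrow> norm t < r \<Longrightarrow>
     ((\<lambda>(i, j). a i j * s ^ i * t ^ j) has_sum f (fst z + s, snd z + t)) UNIV"
    unfolding analytic2_at_def by blast
  have *: "((\<lambda>(i, j). a j i * s ^ i * t ^ j) has_sum
      f (prod.swap (fst (prod.swap z) + s, snd (prod.swap z) + t))) UNIV"
    if "norm s < r" "norm t < r" for s t
  proof -
    have "((\<lambda>(i, j). a i j * t ^ i * s ^ j) has_sum f (fst z + t, snd z + s)) UNIV \<longleftrightarrow>
       ((\<lambda>(i, j). a j i * s ^ i * t ^ j) has_sum f (fst z + t, snd z + s)) UNIV"
      by (rule has_sum_reindex_bij_witness[of _ prod.swap prod.swap]) (auto simp: mult_ac)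
    with s[OF that(2,1)] show ?thesis by simp
  qed
  show ?thesis
    unfolding analytic2_at_def
    by (intro exI[of _ "\<lambda>i j. a j i"] exI[of _ r] conjI r allI impI *)
qed

lemma parametrises_at_swap:
  assumes "parametrises_at x q M p"
  shows "parametrises_at (\<lambda>z. x (prod.swap z)) (prod.swap q) M p"
proof -
  from assms obtain U where xq: "x q = p" and U: "open U" "q \<in> U"
    and "\<forall>U'. open U' \<and> q \<in> U' \<and> U' \<subseteq> U \<longrightarrow>
           (\<exists>W. open W \<and> p \<in> W \<and> M \<inter> W = x ` U' \<inter> W)"
    unfolding parametrises_at_def by auto
  then have im: "\<exists>W. open W \<and> p \<in> W \<and> M \<inter> W = x ` U' \<inter> W"
    if "open U'" "q \<in> U'" "U' \<subseteq> U" for U'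
    using that by simp
  have "\<exists>W. open W \<and> p \<in> W \<and> M \<inter> W = (\<lambda>z. x (prod.swap z)) ` U' \<inter> W"
    if U': "open U'" "prod.swap q \<in> U'" "U' \<subseteq> prod.swap -` U" for U'
  proof -
    have "(\<lambda>z. x (prod.swap z)) ` U' = x ` (prod.swap -` U')"
      by (force simp: image_iff)
    moreover have "prod.swap -` U' \<subseteq> U" using U'(3) by force
    ultimately show ?thesis
      using im[of "prod.swap -` U'"] open_vimage_swap[OF U'(1)] U'(2) by auto
  qed
  then show ?thesis
    unfolding parametrises_at_def using xq U open_vimage_swap[OF U(1)]
    by (intro conjI exI[of _ "prod.swap -` U"]) auto
qed

text \<open>The parametrised surface and the diffeomorphism of the target stay the same; only the source
  diffeomorphism is composed with the interchange of coordinates.\<close>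

lemma analytic_cross_cap_swap:
  assumes "analytic_cross_cap x q M p"
  shows "analytic_cross_cap (\<lambda>z. x (prod.swap z)) (prod.swap q) M p"
proof -
  from assms obtain \<phi> \<Psi> where \<phi>: "diffeo_germ \<phi> q (0, 0)" and \<Psi>: "diffeo_germ \<Psi> (x q) 0"
    and eq: "\<forall>\<^sub>F z in nhds q. \<Psi> (x z) = cross_cap_map (\<phi> z)"
    unfolding analytic_cross_cap_def cross_cap_germ_def by blast
  have "\<forall>\<^sub>F z in nhds (prod.swap q). \<Psi> (x (prod.swap z)) = cross_cap_map (\<phi> (prod.swap z))"
    by (rule eventually_compose_continuous[of "\<lambda>y. \<Psi> (x y) = cross_cap_map (\<phi> y)"])
       (simp_all add: eq linear_continuous_at[OF bounded_linear_swap])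
  with diffeo_germ_swap[OF \<phi>] \<Psi>
  have "cross_cap_germ (\<lambda>z. x (prod.swap z)) (prod.swap q)"
    unfolding cross_cap_germ_def by (auto intro!: exI[of _ "\<lambda>z. \<phi> (prod.swap z)"] exI[of _ \<Psi>])
  with assms show ?thesis
    unfolding analytic_cross_cap_def
    using parametrises_at_swap analytic2_at_swap by blast
qed

section \<open>The multiplicity\<close>

theorem proposition4p4:
  fixes M :: "(real^3) set" and p :: "real^3"
    and x :: "real \<times> real \<Rightarrow> real^3" and q :: "real \<times> real"
  assumes "analytic_cross_cap x q M p"
    and "spacelike_direction (tangential_direction x q) \<or>
         timelike_direction (tangential_direction x q)"
  shows "(\<exists>y r. analytic_cross_cap y r M p \<and> coeff_E y r \<noteq> 0) \<and>
         (\<forall>y r. analytic_cross_cap y r M p \<and> coeff_E y r \<noteq> 0 \<longrightarrow> m_u y r = 1)"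
proof (intro conjI allI impI)
  show "m_u y r = 1" if "analytic_cross_cap y r M p \<and> coeff_E y r \<noteq> 0" for y r
    using that m_u_cross_cap by blast
  have "\<exists>A. has_series (\<lambda>z. x z $ i) q A" for i
    using assms(1) unfolding analytic_cross_cap_def analytic2_at_iff_has_series by blast
  then obtain X where "\<And>i. has_series (\<lambda>z. x z $ i) q (X i)" by metis
  then have dx: "\<forall>\<^sub>F z in nhds q. x differentiable (at z)" by (rule has_series_vec_derivs(1))
  then have dxq: "x differentiable (at q)" by (rule eventually_nhds_x_imp_x)
  \<comment> \<open>Spacelike and timelike directions have in common that they contain no lightlike vectors.\<close>
  have null: "lprod w w \<noteq> 0" if "w \<in> range (frechet_derivative x (at q))" "w \<noteq> 0" for w
    using assms(2) that
    unfolding tangential_direction_def spacelike_direction_def timelike_direction_def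
      spacelike_def timelike_def by fastforce
  show "\<exists>y r. analytic_cross_cap y r M p \<and> coeff_E y r \<noteq> 0"
  proof (cases "d_u x q = 0")
    case False
    then have "coeff_E x q \<noteq> 0" unfolding coeff_E_def by (intro null) (auto simp: d_u_def)
    with assms(1) show ?thesis by blast
  next
    case True
    have "cross_cap_germ x q" using assms(1) by (simp add: analytic_cross_cap_def)
    then obtain h where h: "frechet_derivative x (at q) h \<noteq> 0"
      using cross_cap_germ_derivative_nonzero dx by blast
    have lin: "linear (frechet_derivative x (at q))" by (rule linear_frechet_derivative[OF dxq])
    have "frechet_derivative x (at q) h = fst h *\<^sub>R d_u x q + snd h *\<^sub>R d_v x q"
      using linear_add[OF lin, of "(fst h, 0)" "(0, snd h)"] linear_scale[OF lin, of "fst h" "(1, 0)"]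
        linear_scale[OF lin, of "snd h" "(0, 1)"]
      by (simp add: d_u_def d_v_def)
    with h True have v: "d_v x q \<noteq> 0" by auto
    let ?y = "\<lambda>z. x (prod.swap z)"
    have "(?y has_derivative (\<lambda>w. frechet_derivative x (at q) (prod.swap w))) (at (prod.swap q))"
      by (rule has_derivative_compose[OF bounded_linear_imp_has_derivative[OF bounded_linear_swap]])
         (simp add: has_derivative_frechet[OF dxq])
    then have "d_u ?y (prod.swap q) = d_v x q"
      unfolding d_u_def d_v_def by (simp flip: frechet_derivative_at)
    then have "coeff_E ?y (prod.swap q) \<noteq> 0"
      unfolding coeff_E_def using v by (simp only:) (intro null, auto simp: d_v_def)
    with analytic_cross_cap_swap[OF assms(1)] show ?thesis by blast
  qed
qed

end
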